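(* Let $\alpha>0$, $M>0$, $M_0>0$, $\rho>0$. Let $\mathbf x_1,\dots,\mathbf x_n$ be i.i.d. random vectors in $\mathbb R^p$ with a distribution in $\mathcal P_\alpha=\mathcal P_\alpha(M_0,M,\rho)$ and with $p\times p$ precision matrix $\Omega$, where $p>n^{\frac{1}{2\alpha+1}}$, and let $\hat\Omega_k$ be the tapering estimator with bandwidth $k$ (both defined in the context). Then $\hat\Omega_k$ satisfies $$\sup_{\mathcal P_\alpha}\mathbb P\left\{\|\hat\Omega_k-\Omega\|^2\ \ge\ C\,\frac{k+\log p}{n}+C\,k^{-2\alpha}\right\}=O\left(p^{-15}\right)$$ with $k=o(n)$, $\log p=o(n)$, and a universal constant $C>0$. In particular, the estimator $\hat\Omega=\hat\Omega_k$ with $k=n^{\frac{1}{2\alpha+1}}$ satisfies $$\sup_{\mathcal P_\alpha}\mathbb P\left\{\|\hat\Omega_k-\Omega\|^2\ \ge\ C\,n^{-\frac{2\alpha}{2\alpha+1}}+C\,\frac{\log p}{n}\right\}=O\left(p^{-15}\right).$$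
   Context: $\|\cdot\|$ is the spectral (operator) norm of a matrix. Parameter space. $\mathcal F_\alpha=\mathcal F_\alpha(M_0,M)$ is the set of $p\times p$ precision matrices $\Omega=(\omega_{ij})$ such that $\max_j\sum_{i:|i-j|\ge r}|\omega_{ij}|\le M r^{-\alpha}$ for all integers $r\ge1$, and all eigenvalues of $\Omega$ lie in $[M_0^{-1},M_0]$. Distributions. $\mathcal P_\alpha=\mathcal P_\alpha(M_0,M,\rho)$ is the set of distributions of a random vector $\mathbf x$ in $\mathbb R^p$ whose precision matrix (inverse covariance matrix) $\Omega=\Sigma^{-1}$ belongs to $\mathcal F_\alpha(M_0,M)$ and which are subgaussian: $\mathbb P\{|\mathbf v^\top(\mathbf x-\mathbb E\mathbf x)|>t\}\le e^{-t^2\rho/2}$ for all $t>0$ and all $\mathbf v\in\mathbb R^p$ with $\|\mathbf v\|_2=1$. Estimator. Let $\bar{\mathbf x}=\frac1n\sum_{i=1}^n\mathbf x_i$ and $\hat\Sigma=(\hat\sigma_{ij})=\frac1n\sum_{i=1}^n(\mathbf x_i-\bar{\mathbf x})(\mathbf x_i-\bar{\mathbf x})^\top$. All row and column indices below are understood to be intersected with $\{1,\dots,p\}$. For integers $m\ge1$ and $1-m\le l\le p$, let $J=\{i: l-m\le i<l+2m\}\cap\{1,\dots,p\}$, let $(\breve\omega^l_{ij})_{i,j\in J}$ be the inverse of the submatrix $(\hat\sigma_{ij})_{i,j\in J}$, and let $\hat\Omega_l^{(m)}$ be the $p\times p$ matrix whose $(i,j)$ entry is $\breve\omega^l_{ij}$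 if $l\le i<l+m$ and $l\le j<l+m$, and $0$ otherwise. For a given integer bandwidth $k$, $1\le k\le p$, assumed divisible by 2, the tapering estimator is $$\hat\Omega_k=\frac2k\left(\sum_{l=1-k}^{p}\hat\Omega_l^{(k)}-\sum_{l=1-k/2}^{p}\hat\Omega_l^{(k/2)}\right).$$ *)

theory Defs
  imports
    "HOL-Probability.Probability"
    "HOL-Library.Landau_Symbols"
    "Jordan_Normal_Form.Gauss_Jordan_Elimination"
    "Jordan_Normal_Form.Char_Poly"
    "Jordan_Normal_Form.DL_Submatrix"
begin

(* The dimension p varies with the sample size, so matrices are those of Jordan_Normal_Form.
   Rows and columns are numbered 0, ..., p - 1 throughout, instead of 1, ..., p; the window
   positions l below are shifted by one accordingly. *)

definition spectral_norm :: "real Matrix.mat \<Rightarrow> real" where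
  "spectral_norm A =
     (SUP v\<in>{v \<in> carrier_vec (dim_col A). v \<bullet> v = 1}. sqrt ((A *\<^sub>v v) \<bullet> (A *\<^sub>v v)))"

(* The value 0 for singular matrices is a convention. *)
definition inv_mat :: "real Matrix.mat \<Rightarrow> real Matrix.mat" where
  "inv_mat A = (case mat_inverse A of Some B \<Rightarrow> B | None \<Rightarrow> 0\<^sub>m (dim_row A) (dim_col A))"

definition F_class :: "real \<Rightarrow> real \<Rightarrow> real \<Rightarrow> nat \<Rightarrow> real Matrix.mat set" where
  "F_class \<alpha> M0 M p = {\<Omega> \<in> carrier_mat p p.
     \<Omega>\<^sup>T = \<Omega> \<and>
     (\<forall>r::nat\<ge>1. \<forall>j<p.
        (\<Sum>i | i < p \<and> \<bar>int i - int j\<bar> \<ge> int r. \<bar>\<Omega> $$ (i, j)\<bar>) \<le> M * real r powr (- \<alpha>)) \<and>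
     (\<forall>e. eigenvalue \<Omega> e \<longrightarrow> inverse M0 \<le> e \<and> e \<le> M0)}"

(* A distribution on R^p is a probability measure on the p-fold product of the Borel
   sigma-algebra; the point x stands for the vector Matrix.vec p x. *)
abbreviation borel_vec :: "nat \<Rightarrow> (nat \<Rightarrow> real) measure" where
  "borel_vec p \<equiv> Pi\<^sub>M {..<p} (\<lambda>_. borel)"

definition mean_vec :: "nat \<Rightarrow> (nat \<Rightarrow> real) measure \<Rightarrow> real Matrix.vec" where
  "mean_vec p D = Matrix.vec p (\<lambda>i. \<integral>x. x i \<partial>D)"

definition cov_mat :: "nat \<Rightarrow> (nat \<Rightarrow> real) measure \<Rightarrow> real Matrix.mat" where
  "cov_mat p D = Matrix.mat p p
     (\<lambda>(i, j). \<integral>x. (x i - mean_vec p D $ i) * (x j - mean_vec p D $ j) \<partial>D)"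

definition precision_mat :: "nat \<Rightarrow> (nat \<Rightarrow> real) measure \<Rightarrow> real Matrix.mat" where
  "precision_mat p D = inv_mat (cov_mat p D)"

definition subgaussian :: "real \<Rightarrow> nat \<Rightarrow> (nat \<Rightarrow> real) measure \<Rightarrow> bool" where
  "subgaussian \<rho> p D \<longleftrightarrow>
     (\<forall>v\<in>carrier_vec p. v \<bullet> v = 1 \<longrightarrow>
       (\<forall>t>0. measure D {x \<in> space D. \<bar>v \<bullet> (Matrix.vec p x - mean_vec p D)\<bar> > t}
                \<le> exp (- (t\<^sup>2 * \<rho> / 2))))"

(* Square integrability says that the covariance matrix exists. *)
definition P_class :: "real \<Rightarrow> real \<Rightarrow> real \<Rightarrow> real \<Rightarrow> nat \<Rightarrow> (nat \<Rightarrow> real) measure set" where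
  "P_class \<alpha> M0 M \<rho> p = {D.
     prob_space D \<and> sets D = sets (borel_vec p) \<and>
     (\<forall>i<p. integrable D (\<lambda>x. (x i)\<^sup>2)) \<and>
     invertible_mat (cov_mat p D) \<and>
     precision_mat p D \<in> F_class \<alpha> M0 M p \<and>
     subgaussian \<rho> p D}"

(* A sample X consists of the observations X 0, ..., X (n - 1), each a point of borel_vec p. *)
definition sample_mean :: "nat \<Rightarrow> (nat \<Rightarrow> nat \<Rightarrow> real) \<Rightarrow> nat \<Rightarrow> real" where
  "sample_mean n X i = (\<Sum>s<n. X s i) / real n"

definition sample_cov :: "nat \<Rightarrow> nat \<Rightarrow> (nat \<Rightarrow> nat \<Rightarrow> real) \<Rightarrow> real Matrix.mat" where
  "sample_cov n p X = Matrix.mat p p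
     (\<lambda>(i, j). (\<Sum>s<n. (X s i - sample_mean n X i) * (X s j - sample_mean n X j)) / real n)"

definition window :: "nat \<Rightarrow> nat \<Rightarrow> int \<Rightarrow> nat set" where
  "window p m l = {i. i < p \<and> l - int m \<le> int i \<and> int i < l + 2 * int m}"

(* submatrix renumbers its rows and columns, so the entry of the inverse that belongs to the
   index i of J stands at the position of i in J. *)
definition local_inverse :: "nat \<Rightarrow> real Matrix.mat \<Rightarrow> nat \<Rightarrow> int \<Rightarrow> real Matrix.mat" where
  "local_inverse p S m l =
     (let J = window p m l;
          B = inv_mat (submatrix S J J);
          pos = (\<lambda>i. card {a \<in> J. a < i})
      in Matrix.mat p p (\<lambda>(i, j).
           if l \<le> int i \<and> int i < l + int m \<and> l \<le> int j \<and> int j < l + int m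
           then B $$ (pos i, pos j) else 0))"

definition tapering_estimator ::
    "nat \<Rightarrow> nat \<Rightarrow> nat \<Rightarrow> (nat \<Rightarrow> nat \<Rightarrow> real) \<Rightarrow> real Matrix.mat" where
  "tapering_estimator n p k X = (let S = sample_cov n p X in
     Matrix.mat p p (\<lambda>ij. 2 / real k *
       ((\<Sum>l\<in>{- int k..<int p}. local_inverse p S k l $$ ij) -
        (\<Sum>l\<in>{- int (k div 2)..<int p}. local_inverse p S (k div 2) l $$ ij))))"

(* The sample is i.i.d., so its law is the product measure. The supremum is taken in ennreal,
   where the supremum over an empty class is 0; it is at most 1. *)
definition sup_error_prob ::
    "real \<Rightarrow> real \<Rightarrow> real \<Rightarrow> real \<Rightarrow> nat \<Rightarrow> nat \<Rightarrow> nat \<Rightarrow> real \<Rightarrow> real" where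
  "sup_error_prob \<alpha> M0 M \<rho> n p k b = enn2real
     (SUP D\<in>P_class \<alpha> M0 M \<rho> p.
        emeasure (Pi\<^sub>M {..<n} (\<lambda>_. D))
          {X \<in> space (Pi\<^sub>M {..<n} (\<lambda>_. D)).
             (spectral_norm (tapering_estimator n p k X - precision_mat p D))\<^sup>2 \<ge> b})"

end

theory Submission
  imports Defs
begin

text \<open>If the sample covariance is within \<open>t\<close> of the covariance in operator norm on every window, then each
  local inverse agrees on its core block with \<open>\<Omega>\<close> up to \<open>O(t + k powr (- \<alpha>))\<close>: inverting a window of
  \<open>\<Sigma>\<close> instead of \<open>\<Sigma>\<close> itself only feels the entries of \<open>\<Omega>\<close> that couple the core to the complement of
  the window, and these are at distance at least the bandwidth. Every index lies in at most \<open>k\<close> cores, so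
  averaging the blocks with the factor \<open>2 / k\<close> costs only a constant, and the tapering weights change
  \<open>\<Omega>\<close> only at entries whose distance from the diagonal is at least \<open>k / 2\<close>.

  The deviation \<open>t\<close> of order \<open>sqrt ((k + ln p) / n)\<close> comes from a Chernoff bound for each of the at most
  \<open>4 p 2 ^ (54 k)\<close> vectors in nets of the windows. Centring at the empirical mean only
  subtracts the square of the empirical mean of the centred form, which obeys the same bound.\<close>

section \<open>Bilinear forms on finite index sets\<close>

text \<open>Vectors and matrices are functions and every form carries its index set: a vector on a
  window, extended by 0, is then a vector on the whole set, and all windows are compared with one
  \<open>\<omega>\<close> and one \<open>\<sigma>\<close>. The renumbering done by
  \<open>submatrix\<close> is undone once, in \<open>submatrix_inverse\<close>.

  Squares of subgaussian variables are only subexponential, so the Chernoff bound covers a bounded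
  range of deviations, and the windows can be inverted stably only below a fixed level of
  \<open>t\<close>. This is where k = o(n) and log p = o(n) enter: they push (k + ln p) / n below a
  constant threshold, under which every bound is nonasymptotic and uniform over the class.

  The class bounds eigenvalues, whereas the perturbation argument needs quadratic forms. The passage
  goes through the infimum of the form on the unit sphere, without diagonalisation or a minimiser:
  if the shifted matrix were invertible at that infimum, the form would stay a fixed amount above
  it.

  The exponent 15 is not tight for this choice of constants; the bound obtained is of order
  p^(-53).\<close>

definition apply_on :: "'a set \<Rightarrow> ('a \<Rightarrow> 'a \<Rightarrow> real) \<Rightarrow> ('a \<Rightarrow> real) \<Rightarrow> 'a \<Rightarrow> real" where
  "apply_on I A v i = (\<Sum>j\<in>I. A i j * v j)"

definition bilin :: "'a set \<Rightarrow> ('a \<Rightarrow> 'a \<Rightarrow> real) \<Rightarrow> ('a \<Rightarrow> real) \<Rightarrow> ('a \<Rightarrow> real) \<Rightarrow> real" where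
  "bilin I A u v = (\<Sum>i\<in>I. \<Sum>j\<in>I. u i * A i j * v j)"

lemma L2_set_square: "(L2_set v I)\<^sup>2 = (\<Sum>i\<in>I. (v i)\<^sup>2)"
  by (simp add: L2_set_def sum_nonneg)

lemma abs_sum_mult_le_L2_set: "\<bar>\<Sum>i\<in>I. u i * v i\<bar> \<le> L2_set u I * L2_set v I"
proof -
  have "\<bar>\<Sum>i\<in>I. u i * v i\<bar> \<le> (\<Sum>i\<in>I. \<bar>u i\<bar> * \<bar>v i\<bar>)"
    by (rule order_trans[OF sum_abs]) (simp add: abs_mult)
  also note L2_set_mult_ineq
  finally show ?thesis .
qed

lemma L2_set_superset:
  assumes "finite I" "J \<subseteq> I" "\<And>i. i \<in> I - J \<Longrightarrow> v i = 0"
  shows "L2_set v I = L2_set v J"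
  unfolding L2_set_def using assms by (intro arg_cong[of _ _ sqrt] sum.mono_neutral_right) auto

lemma bilin_apply_on: "bilin I A u v = (\<Sum>i\<in>I. u i * apply_on I A v i)"
  by (simp add: bilin_def apply_on_def sum_distrib_left mult.assoc)

lemma bilin_commute:
  assumes "\<And>i j. i \<in> I \<Longrightarrow> j \<in> I \<Longrightarrow> A i j = A j i"
  shows "bilin I A u v = bilin I A v u"
  unfolding bilin_def
  by (subst sum.swap) (intro sum.cong refl, simp add: assms mult_ac)

lemma bilin_superset:
  assumes "finite I" "J \<subseteq> I" "\<And>i. i \<in> I - J \<Longrightarrow> u i = 0" "\<And>i. i \<in> I - J \<Longrightarrow> v i = 0"
  shows "bilin I A u v = bilin J A u v"
proof -
  have "bilin I A u v = (\<Sum>i\<in>J. \<Sum>j\<in>I. u i * A i j * v j)"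
    unfolding bilin_def using assms by (intro sum.mono_neutral_right) auto
  also have "\<dots> = bilin J A u v"
    unfolding bilin_def using assms by (intro sum.cong sum.mono_neutral_right refl) auto
  finally show ?thesis .
qed

lemma bilin_add_left: "bilin I A (\<lambda>i. u i + v i) w = bilin I A u w + bilin I A v w"
  and bilin_diff_left: "bilin I A (\<lambda>i. u i - v i) w = bilin I A u w - bilin I A v w"
  and bilin_scale_left: "bilin I A (\<lambda>i. c * u i) w = c * bilin I A u w"
  and bilin_add_right: "bilin I A w (\<lambda>i. u i + v i) = bilin I A w u + bilin I A w v"
  and bilin_diff_right: "bilin I A w (\<lambda>i. u i - v i) = bilin I A w u - bilin I A w v"
  and bilin_scale_right: "bilin I A w (\<lambda>i. c * u i) = c * bilin I A w u"
  and bilin_add_matrix: "bilin I (\<lambda>i j. A i j + B i j) u v = bilin I A u v + bilin I B u v"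
  and bilin_diff_matrix: "bilin I (\<lambda>i j. A i j - B i j) u v = bilin I A u v - bilin I B u v"
  and bilin_scale_matrix: "bilin I (\<lambda>i j. c * A i j) u v = c * bilin I A u v"
  by (simp_all add: bilin_def algebra_simps sum.distrib sum_subtractf sum_distrib_left)

lemmas bilin_simps = bilin_add_left bilin_diff_left bilin_scale_left bilin_add_right
  bilin_diff_right bilin_scale_right

lemma parallelogram:
  "(L2_set (\<lambda>i. u i + v i) I)\<^sup>2 + (L2_set (\<lambda>i. u i - v i) I)\<^sup>2 = 2 * ((L2_set u I)\<^sup>2 + (L2_set v I)\<^sup>2)"
  unfolding L2_set_square sum.distrib[symmetric] sum_distrib_left
  by (intro sum.cong refl) (simp add: power2_eq_square algebra_simps)

lemma L2_set_scale_square: "(L2_set (\<lambda>i. c * u i) I)\<^sup>2 = c\<^sup>2 * (L2_set u I)\<^sup>2"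
  unfolding L2_set_square sum_distrib_left power_mult_distrib ..

lemma bilin_eq_0:
  assumes "finite I" "L2_set u I = 0 \<or> L2_set v I = 0"
  shows "bilin I A u v = 0"
  using assms by (auto simp: L2_set_eq_0_iff bilin_def)

lemma bilin_le_of_quadratic:
  assumes fin: "finite I"
    and sym: "\<And>i j. i \<in> I \<Longrightarrow> j \<in> I \<Longrightarrow> A i j = A j i"
    and q: "\<And>v. \<bar>bilin I A v v\<bar> \<le> c * (L2_set v I)\<^sup>2"
  shows "\<bar>bilin I A u v\<bar> \<le> c * L2_set u I * L2_set v I"
proof (cases "L2_set u I = 0 \<or> L2_set v I = 0")
  case True
  then show ?thesis using bilin_eq_0[OF fin True] by auto
next
  case False
  define a b where "a = L2_set u I" and "b = L2_set v I"
  have ab: "a > 0" "b > 0"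
    using False L2_set_nonneg[of u I] L2_set_nonneg[of v I] by (auto simp: a_def b_def less_le)
  \<comment> \<open>Each vector is scaled by the norm of the other, so that both have length
    \<open>a * b\<close>; polarization then loses nothing in the constant \<open>c\<close>.\<close>
  let ?u = "\<lambda>i. b * u i" and ?v = "\<lambda>i. a * v i"
  let ?p = "\<lambda>i. ?u i + ?v i" and ?m = "\<lambda>i. ?u i - ?v i"
  have "4 * (a * b * bilin I A u v) = bilin I A ?p ?p - bilin I A ?m ?m"
    by (simp add: bilin_simps algebra_simps bilin_commute[OF sym, where u=v and v=u])
  then have "\<bar>4 * (a * b * bilin I A u v)\<bar> \<le> \<bar>bilin I A ?p ?p\<bar> + \<bar>bilin I A ?m ?m\<bar>" by linarith
  also have "\<dots> \<le> c * ((L2_set ?p I)\<^sup>2 + (L2_set ?m I)\<^sup>2)"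
    using q[of ?p] q[of ?m] by (simp add: distrib_left)
  also have "\<dots> = 4 * (a * b * (c * a * b))"
    unfolding parallelogram L2_set_scale_square a_def[symmetric] b_def[symmetric]
    by (simp add: power2_eq_square)
  finally have "a * b * \<bar>bilin I A u v\<bar> \<le> a * b * (c * a * b)"
    using ab by (simp add: abs_mult)
  then show ?thesis using ab by (simp add: a_def b_def)
qed

text \<open>In operator terms, 0 \<le> A \<le> K implies A^2 \<le> K A. It follows from
  nonnegativity of the form at \<open>y - A y / K\<close>, where the step length 1 / K is the best
  one for the upper bound K.\<close>

lemma psd_apply_on_le:
  assumes fin: "finite I" and K: "K > 0"
    and sym: "\<And>i j. i \<in> I \<Longrightarrow> j \<in> I \<Longrightarrow> A i j = A j i"
    and psd: "\<And>v. 0 \<le> bilin I A v v"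
    and q: "\<And>v. bilin I A v v \<le> K * (L2_set v I)\<^sup>2"
  shows "(L2_set (apply_on I A y) I)\<^sup>2 \<le> K * bilin I A y y"
proof -
  let ?z = "apply_on I A y" and ?s = "1 / K"
  have *: "bilin I A ?z y = (L2_set ?z I)\<^sup>2"
    unfolding L2_set_square by (simp add: bilin_apply_on power2_eq_square)
  have **: "bilin I A y ?z = (L2_set ?z I)\<^sup>2"
    using bilin_commute[OF sym, where u=y and v="?z"] * by simp
  have "0 \<le> bilin I A (\<lambda>i. y i - ?s * ?z i) (\<lambda>i. y i - ?s * ?z i)" by (rule psd)
  also have "\<dots> = bilin I A y y - 2 * ?s * (L2_set ?z I)\<^sup>2 + ?s * ?s * bilin I A ?z ?z"
    unfolding bilin_diff_left bilin_diff_right bilin_scale_left bilin_scale_right * **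
    by (simp add: algebra_simps)
  also have "\<dots> \<le> bilin I A y y - 2 * ?s * (L2_set ?z I)\<^sup>2 + ?s * ?s * (K * (L2_set ?z I)\<^sup>2)"
    using q[of ?z] K by (intro add_left_mono mult_left_mono) auto
  also have "\<dots> = bilin I A y y - ?s * (L2_set ?z I)\<^sup>2" using K by (simp add: field_simps)
  finally show ?thesis using K by (simp add: field_simps)
qed

text \<open>A crude operator bound. It serves where some finite bound is wanted, for suprema and
  infima over unit vectors; its size disappears from all later constants.\<close>

lemma L2_set_apply_on_le_entries:
  assumes "finite I"
  shows "L2_set (apply_on I A v) I \<le> (\<Sum>i\<in>I. \<Sum>j\<in>I. \<bar>A i j\<bar>) * L2_set v I"
proof -
  have "L2_set (apply_on I A v) I \<le> (\<Sum>i\<in>I. \<bar>apply_on I A v i\<bar>)" by (rule L2_set_le_sum_abs)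
  also have "\<dots> \<le> (\<Sum>i\<in>I. \<Sum>j\<in>I. \<bar>A i j\<bar> * L2_set v I)"
  proof (intro sum_mono)
    fix i assume "i \<in> I"
    have "\<bar>apply_on I A v i\<bar> \<le> (\<Sum>j\<in>I. \<bar>A i j\<bar> * \<bar>v j\<bar>)"
      unfolding apply_on_def by (rule order_trans[OF sum_abs]) (simp add: abs_mult)
    also have "\<dots> \<le> (\<Sum>j\<in>I. \<bar>A i j\<bar> * L2_set v I)"
    proof (intro sum_mono mult_left_mono)
      fix j assume "j \<in> I"
      then show "\<bar>v j\<bar> \<le> L2_set v I"
        using member_le_L2_set[OF assms, of j v] member_le_L2_set[OF assms, of j "\<lambda>j. - v j"]
        by (simp add: L2_set_def)
    qed auto
    finally show "\<bar>apply_on I A v i\<bar> \<le> (\<Sum>j\<in>I. \<bar>A i j\<bar> * L2_set v I)" .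
  qed
  finally show ?thesis by (simp add: sum_distrib_right)
qed

lemma bilin_le_entries:
  assumes "finite I"
  shows "\<bar>bilin I A u v\<bar> \<le> (\<Sum>i\<in>I. \<Sum>j\<in>I. \<bar>A i j\<bar>) * L2_set u I * L2_set v I"
proof -
  have "\<bar>bilin I A u v\<bar> \<le> L2_set u I * L2_set (apply_on I A v) I"
    unfolding bilin_apply_on by (rule abs_sum_mult_le_L2_set)
  also have "\<dots> \<le> L2_set u I * ((\<Sum>i\<in>I. \<Sum>j\<in>I. \<bar>A i j\<bar>) * L2_set v I)"
    by (intro mult_left_mono L2_set_apply_on_le_entries assms) auto
  finally show ?thesis by (simp add: mult_ac)
qed

text \<open>Schur's test: \<open>\<bar>A i j\<bar>\<close> is split into two square roots, one going
  with each vector, and Cauchy-Schwarz is applied over all pairs at once. This turns the decay of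
  row and column sums into an operator bound.\<close>

lemma bilin_schur_test:
  assumes row: "\<And>i. i \<in> I \<Longrightarrow> (\<Sum>j\<in>J. \<bar>A i j\<bar>) \<le> b"
    and col: "\<And>j. j \<in> J \<Longrightarrow> (\<Sum>i\<in>I. \<bar>A i j\<bar>) \<le> b" and b: "b \<ge> 0"
  shows "\<bar>\<Sum>i\<in>I. \<Sum>j\<in>J. u i * A i j * v j\<bar> \<le> b * L2_set u I * L2_set v J"
proof -
  have "\<bar>\<Sum>i\<in>I. \<Sum>j\<in>J. u i * A i j * v j\<bar> \<le> (\<Sum>x\<in>I \<times> J. \<bar>\<bar>u (fst x)\<bar> * sqrt \<bar>A (fst x) (snd x)\<bar>\<bar> * \<bar>sqrt \<bar>A (fst x) (snd x)\<bar> * \<bar>v (snd x)\<bar>\<bar>)"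
  proof -
    have "\<bar>\<Sum>i\<in>I. \<Sum>j\<in>J. u i * A i j * v j\<bar> \<le> (\<Sum>i\<in>I. \<Sum>j\<in>J. \<bar>u i * A i j * v j\<bar>)"
      by (rule order_trans[OF sum_abs] sum_mono sum_abs)+
    also have "\<dots> = (\<Sum>x\<in>I \<times> J. \<bar>u (fst x) * A (fst x) (snd x) * v (snd x)\<bar>)"
      by (simp add: sum.cartesian_product case_prod_beta)
    also have "\<dots> = (\<Sum>x\<in>I \<times> J. \<bar>\<bar>u (fst x)\<bar> * sqrt \<bar>A (fst x) (snd x)\<bar>\<bar> * \<bar>sqrt \<bar>A (fst x) (snd x)\<bar> * \<bar>v (snd x)\<bar>\<bar>)"
      by (intro sum.cong refl) (simp add: abs_mult mult_ac)
    finally show ?thesis .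
  qed
  also have "\<dots> \<le> L2_set (\<lambda>x. \<bar>u (fst x)\<bar> * sqrt \<bar>A (fst x) (snd x)\<bar>) (I \<times> J) *
        L2_set (\<lambda>x. sqrt \<bar>A (fst x) (snd x)\<bar> * \<bar>v (snd x)\<bar>) (I \<times> J)"
    by (rule L2_set_mult_ineq)
  also have "\<dots> \<le> (sqrt b * L2_set u I) * (sqrt b * L2_set v J)"
  proof (intro mult_mono)
    have "(\<Sum>x\<in>I \<times> J. (\<bar>u (fst x)\<bar> * sqrt \<bar>A (fst x) (snd x)\<bar>)\<^sup>2) = (\<Sum>i\<in>I. (u i)\<^sup>2 * (\<Sum>j\<in>J. \<bar>A i j\<bar>))"
      by (simp add: sum_distrib_left sum.cartesian_product case_prod_beta power_mult_distrib)
    also have "\<dots> \<le> (\<Sum>i\<in>I. (u i)\<^sup>2 * b)" by (intro sum_mono mult_left_mono row) auto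
    finally show "L2_set (\<lambda>x. \<bar>u (fst x)\<bar> * sqrt \<bar>A (fst x) (snd x)\<bar>) (I \<times> J) \<le> sqrt b * L2_set u I"
      unfolding L2_set_def real_sqrt_mult[symmetric]
      by (simp add: sum_distrib_left mult.commute)
    have "(\<Sum>x\<in>I \<times> J. (sqrt \<bar>A (fst x) (snd x)\<bar> * \<bar>v (snd x)\<bar>)\<^sup>2) = (\<Sum>i\<in>I. \<Sum>j\<in>J. \<bar>A i j\<bar> * (v j)\<^sup>2)"
      by (simp add: sum.cartesian_product case_prod_beta power_mult_distrib)
    also have "\<dots> = (\<Sum>j\<in>J. (v j)\<^sup>2 * (\<Sum>i\<in>I. \<bar>A i j\<bar>))"
      by (subst sum.swap) (simp add: sum_distrib_left mult.commute)
    also have "\<dots> \<le> (\<Sum>j\<in>J. (v j)\<^sup>2 * b)" by (intro sum_mono mult_left_mono col) auto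
    finally show "L2_set (\<lambda>x. sqrt \<bar>A (fst x) (snd x)\<bar> * \<bar>v (snd x)\<bar>) (I \<times> J) \<le> sqrt b * L2_set v J"
      unfolding L2_set_def real_sqrt_mult[symmetric]
      by (simp add: sum_distrib_left mult.commute)
  qed (use b in auto)
  also have "\<dots> = b * L2_set u I * L2_set v J" using b by (simp add: algebra_simps)
  finally show ?thesis .
qed

section \<open>Extreme eigenvalues and quadratic forms\<close>

lemma quadratic_scaling:
  assumes fin: "finite I"
    and unit: "\<And>v. L2_set v I = 1 \<Longrightarrow> c \<le> bilin I A v v"
  shows "c * (L2_set v I)\<^sup>2 \<le> bilin I A v v"
proof (cases "L2_set v I = 0")
  case True
  then show ?thesis using bilin_eq_0[OF fin, of v v A] by simp
next
  case False
  define a where "a = L2_set v I"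
  have a: "a > 0" using False L2_set_nonneg[of v I] by (auto simp: a_def less_le)
  have "(L2_set (\<lambda>i. inverse a * v i) I)\<^sup>2 = 1"
    unfolding L2_set_scale_square a_def[symmetric] using a by (simp add: field_simps)
  then have "L2_set (\<lambda>i. inverse a * v i) I = 1"
    using L2_set_nonneg[of "\<lambda>i. inverse a * v i" I] by (simp add: power2_eq_1_iff)
  from unit[OF this] have "c \<le> inverse a * (inverse a * bilin I A v v)"
    by (simp only: bilin_simps)
  then show ?thesis unfolding a_def[symmetric] using a by (simp add: field_simps power2_eq_square)
qed

lemma bilin_uminus: "bilin I (\<lambda>i j. - A i j) u v = - bilin I A u v"
  by (simp add: bilin_def sum_negf)

lemma quadratic_scaling_abs:
  assumes fin: "finite I"
    and unit: "\<And>v. L2_set v I = 1 \<Longrightarrow> \<bar>bilin I A v v\<bar> \<le> c"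
  shows "\<bar>bilin I A v v\<bar> \<le> c * (L2_set v I)\<^sup>2"
proof -
  have "- c * (L2_set v I)\<^sup>2 \<le> bilin I A v v"
    by (rule quadratic_scaling[OF fin]) (use unit in force)
  moreover have "- c * (L2_set v I)\<^sup>2 \<le> bilin I (\<lambda>i j. - A i j) v v"
    by (rule quadratic_scaling[OF fin], unfold bilin_uminus) (use unit in force)
  ultimately show ?thesis unfolding bilin_uminus by simp
qed

lemma exists_unit:
  assumes "finite I" "I \<noteq> {}"
  shows "\<exists>v. L2_set v I = 1"
proof -
  from assms obtain a where a: "a \<in> I" by blast
  have "L2_set (\<lambda>i. if i = a then 1 else 0) I = L2_set (\<lambda>i. if i = a then 1 else 0) {a}"
    using a assms by (intro L2_set_superset) auto
  also have "\<dots> = 1" by (simp add: L2_set_def)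
  finally show ?thesis by blast
qed

text \<open>The infimum \<open>\<mu>\<close> of the form over unit vectors cannot lie where the
  shifted matrix is invertible: A - \<mu> is positive semidefinite, and with a left inverse its form
  would be bounded away from 0 on the sphere. The hypothesis \<open>inv\<close> expresses that
  nothing below \<open>lo\<close> is an eigenvalue.\<close>

lemma rayleigh_lower_bound:
  fixes A :: "'a \<Rightarrow> 'a \<Rightarrow> real"
  assumes fin: "finite I" and ne: "I \<noteq> {}"
    and sym: "\<And>i j. i \<in> I \<Longrightarrow> j \<in> I \<Longrightarrow> A i j = A j i"
    and inv: "\<And>e. e < lo \<Longrightarrow>
      \<exists>R. \<forall>y. \<forall>i\<in>I. apply_on I R (\<lambda>i. apply_on I A y i - e * y i) i = y i"
  shows "lo * (L2_set v I)\<^sup>2 \<le> bilin I A v v"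
proof -
  define Q where "Q = (\<lambda>v. bilin I A v v) ` {v. L2_set v I = 1}"
  define \<mu> where "\<mu> = Inf Q"
  have Qne: "Q \<noteq> {}" using exists_unit[OF fin ne] by (auto simp: Q_def)
  have "bdd_below Q"
  proof (rule bdd_belowI)
    fix q assume "q \<in> Q"
    then obtain v where v: "L2_set v I = 1" "q = bilin I A v v" by (auto simp: Q_def)
    then show "- (\<Sum>i\<in>I. \<Sum>j\<in>I. \<bar>A i j\<bar>) \<le> q" using bilin_le_entries[OF fin, of A v v] by auto
  qed
  then have \<mu>_le: "\<mu> \<le> bilin I A v v" if "L2_set v I = 1" for v
    unfolding \<mu>_def using that by (intro cInf_lower) (auto simp: Q_def)
  have "lo \<le> \<mu>"
  proof (rule ccontr)
    assume "\<not> lo \<le> \<mu>"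
    then obtain R where R: "\<And>y i. i \<in> I \<Longrightarrow> apply_on I R (\<lambda>i. apply_on I A y i - \<mu> * y i) i = y i"
      using inv[of \<mu>] by auto
    define B where "B i j = A i j - (if i = j then \<mu> else 0)" for i j
    have B_apply: "apply_on I B y i = apply_on I A y i - \<mu> * y i" if "i \<in> I" for y i
    proof -
      have "apply_on I B y i = apply_on I A y i - (\<Sum>j\<in>I. if i = j then \<mu> * y j else 0)"
        unfolding apply_on_def B_def sum_subtractf[symmetric] by (intro sum.cong) (auto simp: algebra_simps)
      also have "(\<Sum>j\<in>I. if i = j then \<mu> * y j else 0) = \<mu> * y i" using that fin by simp
      finally show ?thesis .
    qed
    have B_bilin: "bilin I B v v = bilin I A v v - \<mu> * (L2_set v I)\<^sup>2" for v
    proof -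
      have "bilin I B v v = (\<Sum>i\<in>I. v i * (apply_on I A v i - \<mu> * v i))"
        unfolding bilin_apply_on by (intro sum.cong refl) (simp add: B_apply)
      then show ?thesis unfolding bilin_apply_on L2_set_square
        by (simp add: algebra_simps sum_subtractf sum_distrib_left power2_eq_square)
    qed
    have psd: "0 \<le> bilin I B v v" for v
      using quadratic_scaling[OF fin, of \<mu> A v] \<mu>_le B_bilin by auto
    \<comment> \<open>The added 1 keeps both bounds positive even if all entries vanish, so that
      they can be divided by.\<close>
    define K where "K = (\<Sum>i\<in>I. \<Sum>j\<in>I. \<bar>B i j\<bar>) + 1"
    define K' where "K' = (\<Sum>i\<in>I. \<Sum>j\<in>I. \<bar>R i j\<bar>) + 1"
    have "0 \<le> (\<Sum>i\<in>I. \<Sum>j\<in>I. \<bar>B i j\<bar>)" "0 \<le> (\<Sum>i\<in>I. \<Sum>j\<in>I. \<bar>R i j\<bar>)"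
      by (intro sum_nonneg; simp)+
    then have K: "K > 0" "K' > 0" by (auto simp: K_def K'_def)
    have qK: "bilin I B v v \<le> K * (L2_set v I)\<^sup>2" for v
    proof -
      have "bilin I B v v \<le> (\<Sum>i\<in>I. \<Sum>j\<in>I. \<bar>B i j\<bar>) * (L2_set v I)\<^sup>2"
        using bilin_le_entries[OF fin, of B v v] by (simp add: power2_eq_square mult.assoc)
      also have "\<dots> \<le> K * (L2_set v I)\<^sup>2" unfolding K_def by (intro mult_right_mono) auto
      finally show ?thesis .
    qed
    have symB: "B i j = B j i" if "i \<in> I" "j \<in> I" for i j using sym that by (auto simp: B_def)
    \<comment> \<open>A unit vector satisfies 1 = |R B v| \<le> K' |B v|, and |B v|^2 \<le> K B(v,
      v) since B is positive semidefinite. Hence the form of \<open>A\<close> exceeds its own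
      infimum by a fixed amount.\<close>
    have low: "\<mu> + 1 / (K'\<^sup>2 * K) \<le> bilin I A v v" if v: "L2_set v I = 1" for v
    proof -
      have "L2_set v I = L2_set (apply_on I R (apply_on I B v)) I"
      proof (rule L2_set_cong[OF refl])
        fix i assume i: "i \<in> I"
        have "apply_on I R (apply_on I B v) i = apply_on I R (\<lambda>i. apply_on I A v i - \<mu> * v i) i"
          unfolding apply_on_def[of I R] by (intro sum.cong refl) (simp add: B_apply)
        then show "v i = apply_on I R (apply_on I B v) i" using R[OF i] by simp
      qed
      also have "\<dots> \<le> (\<Sum>i\<in>I. \<Sum>j\<in>I. \<bar>R i j\<bar>) * L2_set (apply_on I B v) I"
        by (rule L2_set_apply_on_le_entries[OF fin])
      also have "\<dots> \<le> K' * L2_set (apply_on I B v) I"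
        unfolding K'_def by (intro mult_right_mono) auto
      finally have "1 \<le> K' * L2_set (apply_on I B v) I" using v by simp
      then have "1\<^sup>2 \<le> (K' * L2_set (apply_on I B v) I)\<^sup>2" by (intro power_mono) auto
      also have "\<dots> \<le> K'\<^sup>2 * (K * bilin I B v v)"
        unfolding power_mult_distrib
        using psd_apply_on_le[OF fin K(1) symB psd qK, of v] by (intro mult_left_mono) auto
      finally have "1 / (K'\<^sup>2 * K) \<le> bilin I B v v" using K by (simp add: field_simps)
      then show ?thesis using B_bilin[of v] v by simp
    qed
    have "\<mu> + 1 / (K'\<^sup>2 * K) \<le> \<mu>"
      unfolding \<mu>_def by (rule cInf_greatest[OF Qne]) (use low in \<open>auto simp: Q_def \<mu>_def\<close>)
    moreover have "1 / (K'\<^sup>2 * K) > 0" using K by simp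
    ultimately show False by linarith
  qed
  then show ?thesis by (intro quadratic_scaling[OF fin]) (use \<mu>_le order_trans in blast)
qed

section \<open>Operator norms from nets\<close>

lemma sum_half_power_abs_le: "(\<Sum>z\<in>{- int L..int L}. (1/2::real) ^ nat \<bar>z\<bar>) \<le> 3"
proof -
  have "(\<Sum>z\<in>{- int L..int L}. (1/2::real) ^ nat \<bar>z\<bar>) = 3 - 2 * (1/2) ^ L"
  proof (induction L)
    case (Suc L)
    have "{- int (Suc L)..int (Suc L)} = insert (- int (Suc L)) (insert (int (Suc L)) {- int L..int L})"
      by auto
    then show ?case using Suc by (simp add: nat_add_distrib)
  qed simp
  then show ?thesis by simp
qed

text \<open>Weighting each integer point by \<open>2 ^ (c - \<Sum>\<bar>z i\<bar>)\<close>, which is at least 1 on the set, turns the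
  count into a product of one-dimensional geometric sums.\<close>

lemma card_integer_points_le:
  assumes fin: "finite J"
  shows "card {z \<in> J \<rightarrow>\<^sub>E {- int L..int L}. (\<Sum>i\<in>J. nat \<bar>z i\<bar>) \<le> c} \<le> 2 ^ c * 3 ^ card J"
proof -
  let ?P = "J \<rightarrow>\<^sub>E {- int L..int L}"
  let ?S = "{z \<in> ?P. (\<Sum>i\<in>J. nat \<bar>z i\<bar>) \<le> c}"
  have finP: "finite ?P" using fin by (intro finite_PiE) auto
  have "real (card ?S) = (\<Sum>z\<in>?S. 1)" by simp
  also have "\<dots> \<le> (\<Sum>z\<in>?S. 2 ^ c * (\<Prod>i\<in>J. (1/2::real) ^ nat \<bar>z i\<bar>))"
  proof (intro sum_mono)
    fix z assume z: "z \<in> ?S"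
    have "(1::real) = 2 ^ c * (1/2) ^ c" by (simp add: power_mult_distrib[symmetric])
    also have "\<dots> \<le> 2 ^ c * (1/2) ^ (\<Sum>i\<in>J. nat \<bar>z i\<bar>)"
      using z by (intro mult_left_mono power_decreasing) auto
    finally show "1 \<le> 2 ^ c * (\<Prod>i\<in>J. (1/2::real) ^ nat \<bar>z i\<bar>)" by (simp add: power_sum)
  qed
  also have "\<dots> \<le> (\<Sum>z\<in>?P. 2 ^ c * (\<Prod>i\<in>J. (1/2::real) ^ nat \<bar>z i\<bar>))"
    using finP by (intro sum_mono2) (auto intro!: mult_nonneg_nonneg prod_nonneg)
  also have "\<dots> = 2 ^ c * (\<Prod>i\<in>J. \<Sum>z\<in>{- int L..int L}. (1/2::real) ^ nat \<bar>z\<bar>)"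
    unfolding sum_distrib_left[symmetric] using fin by (subst prod_sum_PiE) auto
  also have "\<dots> \<le> 2 ^ c * (\<Prod>i\<in>J. 3)"
    by (intro mult_left_mono prod_mono conjI sum_half_power_abs_le sum_nonneg) auto
  finally have "real (card ?S) \<le> real (2 ^ c * 3 ^ card J)" by simp
  then show ?thesis by linarith
qed

text \<open>Rounding towards 0 keeps the net points inside the unit ball.\<close>

definition trunc :: "real \<Rightarrow> int" where
  "trunc x = (if x \<ge> 0 then \<lfloor>x\<rfloor> else \<lceil>x\<rceil>)"

lemma trunc_bounds: "\<bar>real_of_int (trunc x)\<bar> \<le> \<bar>x\<bar>" "\<bar>x - real_of_int (trunc x)\<bar> \<le> 1"
  unfolding trunc_def by (auto split: if_splits) linarith+

text \<open>The mesh is 1 / (4 sqrt d) with d = \<open>card J\<close>, so that rounding d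
  coordinates costs at most 1/4 in norm. The bound on the sum of the |z i| stands in for the
  Euclidean ball, because it can be counted coordinate by coordinate. Values 0 off \<open>J\<close>
  let the net vectors act on the whole index set.\<close>

definition grid_net :: "nat set \<Rightarrow> (nat \<Rightarrow> real) set" where
  "grid_net J = (\<lambda>z i. if i \<in> J then real_of_int (z i) / (4 * sqrt (card J)) else 0) `
     {z \<in> J \<rightarrow>\<^sub>E {- int (16 * card J)..int (16 * card J)}. (\<Sum>i\<in>J. nat \<bar>z i\<bar>) \<le> 16 * card J}"

lemma grid_net_card:
  assumes "finite J"
  shows "finite (grid_net J)" "card (grid_net J) \<le> 2 ^ (18 * card J)"
proof -
  let ?S = "{z \<in> J \<rightarrow>\<^sub>E {- int (16 * card J)..int (16 * card J)}. (\<Sum>i\<in>J. nat \<bar>z i\<bar>) \<le> 16 * card J}"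
  have fin: "finite ?S"
    by (rule finite_subset[of _ "J \<rightarrow>\<^sub>E {- int (16 * card J)..int (16 * card J)}"])
      (use assms in \<open>auto intro!: finite_PiE\<close>)
  then show "finite (grid_net J)" by (simp add: grid_net_def)
  have "card (grid_net J) \<le> card ?S" unfolding grid_net_def by (rule card_image_le[OF fin])
  also have "\<dots> \<le> 2 ^ (16 * card J) * 3 ^ card J" by (rule card_integer_points_le[OF assms])
  \<comment> \<open>3 is rounded up to 4 to keep the count a power of 2. A window has at most
    \<open>3 * k\<close> indices, whence the later exponent 54 = 3 * 18.\<close>
  also have "\<dots> \<le> 2 ^ (16 * card J) * 4 ^ card J" by (intro mult_left_mono power_mono) auto
  also have "(4::nat) ^ card J = 2 ^ (2 * card J)" by (simp add: power_mult)
  also have "(2::nat) ^ (16 * card J) * 2 ^ (2 * card J) = 2 ^ (18 * card J)"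
    by (simp add: power_add[symmetric])
  finally show "card (grid_net J) \<le> 2 ^ (18 * card J)" .
qed

lemma grid_net_approx:
  assumes fin: "finite J" and v: "L2_set v J = 1"
  obtains w where "w \<in> grid_net J" "L2_set w J \<le> 1" "L2_set (\<lambda>i. v i - w i) J \<le> 1 / 4"
proof -
  have "J \<noteq> {}" using v by auto
  then have d: "card J > 0" using fin by (simp add: card_gt_0_iff)
  define \<delta> where "\<delta> = 1 / (4 * sqrt (card J))"
  have \<delta>: "\<delta> > 0" using d by (simp add: \<delta>_def)
  have \<delta>2: "\<delta>\<^sup>2 = 1 / (16 * card J)" using d by (simp add: \<delta>_def power_divide power_mult_distrib)
  define z where "z = (\<lambda>i\<in>J. trunc (v i / \<delta>))"
  define w where "w i = (if i \<in> J then real_of_int (z i) / (4 * sqrt (card J)) else 0)" for i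
  have w: "w i = \<delta> * trunc (v i / \<delta>)" if "i \<in> J" for i using that by (simp add: w_def z_def \<delta>_def)
  have w_le: "\<bar>w i\<bar> \<le> \<bar>v i\<bar>" if "i \<in> J" for i
    using trunc_bounds(1)[of "v i / \<delta>"] \<delta> by (simp add: w[OF that] abs_mult field_simps)
  have vw: "\<bar>v i - w i\<bar> \<le> \<delta>" if "i \<in> J" for i
  proof -
    have "v i - w i = \<delta> * (v i / \<delta> - trunc (v i / \<delta>))" using \<delta> by (simp add: w[OF that] field_simps)
    then have "\<bar>v i - w i\<bar> = \<delta> * \<bar>v i / \<delta> - trunc (v i / \<delta>)\<bar>" using \<delta> by (simp add: abs_mult)
    also have "\<dots> \<le> \<delta> * 1" using trunc_bounds(2) \<delta> by (intro mult_left_mono) auto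
    finally show ?thesis by simp
  qed
  have L: "L2_set w J \<le> L2_set v J"
    unfolding L2_set_def by (intro real_sqrt_le_mono sum_mono abs_le_square_iff[THEN iffD1] w_le)
  have "L2_set (\<lambda>i. v i - w i) J \<le> L2_set (\<lambda>_. \<delta>) J"
    unfolding L2_set_def using vw \<delta>
    by (intro real_sqrt_le_mono sum_mono abs_le_square_iff[THEN iffD1]) auto
  also have "\<dots> = 1 / 4" using d \<delta> by (simp add: L2_set_constant \<delta>_def)
  finally have L2: "L2_set (\<lambda>i. v i - w i) J \<le> 1 / 4" .
  \<comment> \<open>An integer satisfies \<open>\<bar>z\<bar> \<le> z\<^sup>2\<close>, so the sum of
    the |z i| is at most the squared Euclidean norm, which is at most 1 / \<delta>^2 = 16 d.\<close>
  have sumz: "(\<Sum>i\<in>J. nat \<bar>z i\<bar>) \<le> 16 * card J"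
  proof -
    have "real (\<Sum>i\<in>J. nat \<bar>z i\<bar>) \<le> (\<Sum>i\<in>J. (real_of_int (z i))\<^sup>2)"
      unfolding of_nat_sum
    proof (intro sum_mono)
      fix i
      have "\<bar>z i\<bar> \<le> (z i)\<^sup>2"
      proof (cases "z i = 0")
        case False
        then have "\<bar>z i\<bar> * 1 \<le> \<bar>z i\<bar> * \<bar>z i\<bar>" by (intro mult_left_mono) auto
        then show ?thesis by (simp add: power2_eq_square)
      qed simp
      then have "real_of_int \<bar>z i\<bar> \<le> real_of_int ((z i)\<^sup>2)" by (rule of_int_le_iff[THEN iffD2])
      then show "real (nat \<bar>z i\<bar>) \<le> (real_of_int (z i))\<^sup>2" by simp
    qed
    also have "\<dots> = (\<Sum>i\<in>J. (w i)\<^sup>2 / \<delta>\<^sup>2)"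
      using \<delta> by (intro sum.cong refl) (simp add: w z_def field_simps)
    also have "\<dots> = (L2_set w J)\<^sup>2 / \<delta>\<^sup>2" by (simp add: L2_set_square sum_divide_distrib)
    also have "\<dots> \<le> 1 / \<delta>\<^sup>2" using L v \<delta> by (intro divide_right_mono power_le_one) auto
    also have "\<dots> = real (16 * card J)" using \<delta>2 d by simp
    finally show ?thesis by linarith
  qed
  have "z \<in> J \<rightarrow>\<^sub>E {- int (16 * card J)..int (16 * card J)}"
  proof (intro PiE_I)
    fix i assume i: "i \<in> J"
    have "nat \<bar>z i\<bar> \<le> (\<Sum>i\<in>J. nat \<bar>z i\<bar>)" using i fin by (intro member_le_sum) auto
    with sumz show "z i \<in> {- int (16 * card J)..int (16 * card J)}" by auto
  qed (simp add: z_def)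
  with sumz have "w \<in> grid_net J" unfolding grid_net_def w_def[abs_def] by blast
  with that show ?thesis using L L2 v by auto
qed

text \<open>A self-bounding argument for the supremum \<open>q\<close> of the form on the unit
  sphere. By symmetry, v and a net point w differ in their quadratic values by the bilinear value at
  v - w and v + w, whose norms are at most 1/4 and 2. Hence q \<le> t + q / 2.\<close>

lemma bilin_le_of_grid_net:
  assumes fin: "finite J"
    and sym: "\<And>i j. i \<in> J \<Longrightarrow> j \<in> J \<Longrightarrow> A i j = A j i"
    and net: "\<And>w. w \<in> grid_net J \<Longrightarrow> \<bar>bilin J A w w\<bar> \<le> t * (L2_set w J)\<^sup>2" and t: "t \<ge> 0"
  shows "\<bar>bilin J A u v\<bar> \<le> 2 * t * L2_set u J * L2_set v J"
proof (cases "J = {}")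
  case True
  then show ?thesis by (simp add: bilin_def)
next
  case False
  define Q where "Q = (\<lambda>v. \<bar>bilin J A v v\<bar>) ` {v. L2_set v J = 1}"
  define q where "q = Sup Q"
  have Qne: "Q \<noteq> {}" using exists_unit[OF fin False] by (auto simp: Q_def)
  have "bdd_above Q"
  proof (rule bdd_aboveI)
    fix x assume "x \<in> Q"
    then obtain v where v: "L2_set v J = 1" "x = \<bar>bilin J A v v\<bar>" by (auto simp: Q_def)
    then show "x \<le> (\<Sum>i\<in>J. \<Sum>j\<in>J. \<bar>A i j\<bar>)"
      using bilin_le_entries[OF fin, of A v v] by auto
  qed
  then have unit: "\<bar>bilin J A v v\<bar> \<le> q" if "L2_set v J = 1" for v
    unfolding q_def using that by (intro cSup_upper) (auto simp: Q_def)
  have q0: "q \<ge> 0" using exists_unit[OF fin False] unit by force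
  have bil: "\<bar>bilin J A u v\<bar> \<le> q * L2_set u J * L2_set v J" for u v
    by (intro bilin_le_of_quadratic quadratic_scaling_abs fin sym unit)
  have "q \<le> t + q / 2"
    unfolding q_def
  proof (rule cSup_least[OF Qne], fold q_def)
    fix x assume "x \<in> Q"
    then obtain v where v: "L2_set v J = 1" "x = \<bar>bilin J A v v\<bar>" by (auto simp: Q_def)
    obtain w where w: "w \<in> grid_net J" "L2_set w J \<le> 1" "L2_set (\<lambda>i. v i - w i) J \<le> 1 / 4"
      using grid_net_approx[OF fin v(1)] .
    have "bilin J A v v - bilin J A w w = bilin J A (\<lambda>i. v i - w i) (\<lambda>i. v i + w i)"
      by (simp add: bilin_simps bilin_commute[OF sym, where u=w and v=v])
    also have "\<bar>\<dots>\<bar> \<le> q * L2_set (\<lambda>i. v i - w i) J * L2_set (\<lambda>i. v i + w i) J" by (rule bil)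
    also have "\<dots> \<le> q * (1/4) * 2"
      using w v q0 L2_set_triangle_ineq[of v w J] by (intro mult_mono) auto
    finally have "\<bar>bilin J A v v\<bar> \<le> \<bar>bilin J A w w\<bar> + q / 2" by linarith
    moreover have "\<bar>bilin J A w w\<bar> \<le> t * 1"
      using w(2) t by (intro order_trans[OF net[OF w(1)]] mult_left_mono power_le_one) auto
    ultimately show "x \<le> t + q / 2" using v(2) by linarith
  qed
  then have "q \<le> 2 * t" by simp
  then have "q * (L2_set u J * L2_set v J) \<le> 2 * t * (L2_set u J * L2_set v J)"
    by (intro mult_right_mono mult_nonneg_nonneg) auto
  then show ?thesis using bil[of u v] by (simp add: mult.assoc)
qed

section \<open>Perturbation of local inverses\<close>

lemma le_of_square_le:
  fixes x :: real
  assumes "x\<^sup>2 \<le> x * c" "0 \<le> x" "0 \<le> c"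
  shows "x \<le> c"
  using assms by (cases "x = 0") (auto simp: power2_eq_square)

lemma bilin_cong:
  assumes "\<And>i. i \<in> I \<Longrightarrow> u i = u' i" "\<And>i. i \<in> I \<Longrightarrow> v i = v' i"
    and "\<And>i j. i \<in> I \<Longrightarrow> j \<in> I \<Longrightarrow> A i j = A' i j"
  shows "bilin I A u v = bilin I A' u' v'"
  unfolding bilin_def using assms by (intro sum.cong refl) auto

text \<open>If \<open>g\<close> inverts \<open>S\<close> on the window \<open>J\<close> and \<open>h = g v\<close>, then \<open>\<sigma> h = v + e + z\<close> with \<open>e\<close> the sampling
  error on \<open>J\<close> and \<open>z\<close> supported off \<open>J\<close>. Hence \<open>h - \<omega> v = \<omega> e + \<omega> z\<close>, and \<open>z\<close> is small because
  \<open>h\<close> vanishes off \<open>J\<close> while \<open>\<omega>\<close> nearly decouples the core \<open>K\<close> from the complement of \<open>J\<close>.\<close>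

lemma window_perturbation:
  fixes \<omega> \<sigma> S g :: "'a \<Rightarrow> 'a \<Rightarrow> real"
  assumes fin: "finite I" and JI: "J \<subseteq> I" and KJ: "K \<subseteq> J"
    and inv: "\<And>i k. i \<in> I \<Longrightarrow> k \<in> I \<Longrightarrow> (\<Sum>j\<in>I. \<omega> i j * \<sigma> j k) = (if i = k then 1 else 0)"
    and sym: "\<And>i j. i \<in> I \<Longrightarrow> j \<in> I \<Longrightarrow> \<omega> i j = \<omega> j i"
    and M0: "M0 > 0"
    and \<omega>_low: "\<And>v. (L2_set v I)\<^sup>2 / M0 \<le> bilin I \<omega> v v"
    and \<omega>_up: "\<And>u v. \<bar>bilin I \<omega> u v\<bar> \<le> M0 * L2_set u I * L2_set v I"
    and \<sigma>_low: "\<And>v. (L2_set v I)\<^sup>2 / M0 \<le> bilin I \<sigma> v v"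
    and off: "\<And>u. (\<And>i. i \<notin> K \<Longrightarrow> u i = 0) \<Longrightarrow> L2_set (apply_on I \<omega> u) (I - J) \<le> \<beta> * L2_set u K"
    and S: "\<And>u v. \<bar>bilin J (\<lambda>i j. S i j - \<sigma> i j) u v\<bar> \<le> t * L2_set u J * L2_set v J"
    and t: "0 \<le> t" "t \<le> 1 / (2 * M0)" and \<beta>: "\<beta> \<ge> 0"
    and g: "\<And>i k. i \<in> J \<Longrightarrow> k \<in> J \<Longrightarrow> (\<Sum>j\<in>J. S i j * g j k) = (if i = k then 1 else 0)"
  shows "\<bar>bilin K (\<lambda>i j. g i j - \<omega> i j) u v\<bar> \<le>
    (2 * M0\<^sup>2 * t + \<beta> * M0 * (\<beta> + 2 * M0\<^sup>2 * t)) * L2_set u K * L2_set v K"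
proof -
  have KI: "K \<subseteq> I" using KJ JI by blast
  have finJ: "finite J" "finite K" using finite_subset[OF JI fin] finite_subset[OF KI fin] .
  define u' where "u' i = (if i \<in> K then u i else 0)" for i
  define v' where "v' i = (if i \<in> K then v i else 0)" for i
  define h where "h i = (if i \<in> J then \<Sum>j\<in>K. g i j * v j else 0)" for i
  define \<Delta> where "\<Delta> i j = S i j - \<sigma> i j" for i j
  define e where "e i = (if i \<in> J then - apply_on J \<Delta> h i else 0)" for i
  define z where "z i = (if i \<in> I - J then apply_on I \<sigma> h i else 0)" for i
  define y where "y i = v' i + e i + z i" for i
  have n: "L2_set u' I = L2_set u K" "L2_set v' I = L2_set v K" "L2_set v' J = L2_set v K"
      "L2_set u' K = L2_set u K" "L2_set v' K = L2_set v K"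
    using L2_set_superset[OF fin KI, of u'] L2_set_superset[OF fin KI, of v']
      L2_set_superset[OF finJ(1) KJ, of v']
    by (auto simp: u'_def v'_def cong: L2_set_cong)
  have hI: "L2_set h I = L2_set h J" and eI: "L2_set e I = L2_set e J" and zI: "L2_set z I = L2_set z (I - J)"
    using fin JI by (auto intro!: L2_set_superset simp: h_def e_def z_def)
  have Sh: "apply_on J S h i = v' i" if i: "i \<in> J" for i
  proof -
    have "apply_on J S h i = (\<Sum>a\<in>J. \<Sum>j\<in>K. S i a * g a j * v j)"
      unfolding apply_on_def h_def by (intro sum.cong refl) (simp add: sum_distrib_left mult.assoc)
    also have "\<dots> = (\<Sum>j\<in>K. (\<Sum>a\<in>J. S i a * g a j) * v j)"
      by (subst sum.swap) (simp add: sum_distrib_right)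
    also have "\<dots> = (\<Sum>j\<in>K. if i = j then v j else 0)"
      using g i KJ by (intro sum.cong refl) auto
    also have "\<dots> = v' i" using finJ by (simp add: v'_def)
    finally show ?thesis .
  qed
  \<comment> \<open>Coercivity of \<open>\<sigma>\<close>, tested with \<open>h\<close>. Since
    \<open>t\<close> is at most half of the lower bound 1 / M0, the error term is absorbed on the
    left at the cost of a factor 2.\<close>
  have h_le: "L2_set h J \<le> 2 * M0 * L2_set v K"
  proof -
    have "(L2_set h J)\<^sup>2 / M0 \<le> bilin J \<sigma> h h"
      using \<sigma>_low[of h] hI bilin_superset[OF fin JI, of h h \<sigma>] by (auto simp: h_def)
    also have "\<dots> = bilin J S h h - bilin J \<Delta> h h" unfolding \<Delta>_def bilin_diff_matrix by simp
    also have "bilin J S h h = (\<Sum>i\<in>J. h i * v' i)"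
      unfolding bilin_apply_on by (intro sum.cong refl) (simp add: Sh)
    also have "\<dots> - bilin J \<Delta> h h \<le> L2_set h J * L2_set v K + t * L2_set h J * L2_set h J"
      using abs_sum_mult_le_L2_set[of h v' J] S[of h h] n by (simp add: \<Delta>_def[abs_def])
    also have "\<dots> \<le> L2_set h J * L2_set v K + 1 / (2 * M0) * L2_set h J * L2_set h J"
      using t by (intro add_left_mono mult_right_mono) auto
    finally have "(L2_set h J)\<^sup>2 \<le> L2_set h J * (2 * M0 * L2_set v K)"
      using M0 by (simp add: field_simps power2_eq_square)
    then show ?thesis by (rule le_of_square_le) (use M0 in auto)
  qed
  have e_le: "L2_set e J \<le> t * L2_set h J"
  proof -
    have "(L2_set e J)\<^sup>2 = - bilin J \<Delta> e h"
      unfolding L2_set_square bilin_apply_on sum_negf[symmetric]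
      by (intro sum.cong refl) (simp add: e_def power2_eq_square)
    also have "\<dots> \<le> t * L2_set e J * L2_set h J" using S[of e h] by (simp add: \<Delta>_def[abs_def])
    finally have "(L2_set e J)\<^sup>2 \<le> L2_set e J * (t * L2_set h J)" by (simp only: mult_ac)
    then show ?thesis by (rule le_of_square_le) (use t in auto)
  qed
  have \<sigma>h: "apply_on I \<sigma> h i = y i" if i: "i \<in> I" for i
  proof (cases "i \<in> J")
    case True
    have "apply_on I \<sigma> h i = apply_on J \<sigma> h i"
      unfolding apply_on_def using fin JI by (intro sum.mono_neutral_right) (auto simp: h_def)
    also have "\<dots> = apply_on J S h i - apply_on J \<Delta> h i"
      by (simp add: apply_on_def \<Delta>_def algebra_simps sum_subtractf)
    finally show ?thesis using True Sh by (simp add: y_def e_def z_def)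
  next
    case False
    then show ?thesis using i KJ by (auto simp: y_def e_def z_def v'_def)
  qed
  have pair: "(\<Sum>i\<in>I. x i * h i) = bilin I \<omega> x v' + bilin I \<omega> x e + bilin I \<omega> x z" for x
  proof -
    have "h i = apply_on I \<omega> y i" if i: "i \<in> I" for i
    proof -
      have "apply_on I \<omega> y i = apply_on I \<omega> (apply_on I \<sigma> h) i"
        unfolding apply_on_def[of I \<omega>] by (intro sum.cong refl) (simp add: \<sigma>h)
      also have "\<dots> = (\<Sum>a\<in>I. \<Sum>j\<in>I. \<omega> i a * \<sigma> a j * h j)"
        by (simp add: apply_on_def sum_distrib_left mult.assoc)
      also have "\<dots> = (\<Sum>j\<in>I. (\<Sum>a\<in>I. \<omega> i a * \<sigma> a j) * h j)"
        by (subst sum.swap) (simp add: sum_distrib_right)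
      also have "\<dots> = (\<Sum>j\<in>I. if i = j then h j else 0)"
        using inv i by (intro sum.cong refl) auto
      finally show ?thesis using i fin by simp
    qed
    then have "(\<Sum>i\<in>I. x i * h i) = bilin I \<omega> x y"
      unfolding bilin_apply_on by (intro sum.cong refl) simp
    also have "\<dots> = bilin I \<omega> x v' + bilin I \<omega> x e + bilin I \<omega> x z"
      unfolding y_def bilin_add_right ..
    finally show ?thesis .
  qed
  have zx: "\<bar>bilin I \<omega> z x\<bar> \<le> L2_set z I * (\<beta> * L2_set x K)" if x: "\<And>i. i \<notin> K \<Longrightarrow> x i = 0" for x
  proof -
    have "bilin I \<omega> z x = (\<Sum>i\<in>I - J. z i * apply_on I \<omega> x i)"
      unfolding bilin_apply_on using fin by (intro sum.mono_neutral_right) (auto simp: z_def)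
    also have "\<bar>\<dots>\<bar> \<le> L2_set z (I - J) * L2_set (apply_on I \<omega> x) (I - J)"
      by (rule abs_sum_mult_le_L2_set)
    also have "\<dots> \<le> L2_set z I * (\<beta> * L2_set x K)"
      unfolding zI using x by (intro mult_left_mono off) auto
    finally show ?thesis .
  qed
  \<comment> \<open>\<open>z\<close> lives off \<open>J\<close> and \<open>h\<close> on
    \<open>J\<close>, so their pairing vanishes. Then \<open>pair\<close> with \<open>x = z\<close>
    expresses \<omega>(z, z) through \<open>v'\<close> and \<open>e\<close>: the coupling to
    \<open>v'\<close> carries the small factor \<open>\<beta>\<close>, and \<open>e\<close> is of
    order \<open>t\<close>.\<close>
  have z_le: "L2_set z I \<le> M0 * (\<beta> * L2_set v K + M0 * L2_set e J)"
  proof -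
    have "(\<Sum>i\<in>I. z i * h i) = 0" by (intro sum.neutral) (auto simp: z_def h_def)
    then have "bilin I \<omega> z z = - bilin I \<omega> z v' - bilin I \<omega> z e" using pair[of z] by simp
    then have "(L2_set z I)\<^sup>2 / M0 \<le> \<bar>bilin I \<omega> z v'\<bar> + \<bar>bilin I \<omega> z e\<bar>" using \<omega>_low[of z] by linarith
    also have "\<dots> \<le> L2_set z I * (\<beta> * L2_set v K) + M0 * L2_set z I * L2_set e J"
      using zx[of v'] \<omega>_up[of z e] n eI by (intro add_mono) (auto simp: v'_def[abs_def])
    finally have "(L2_set z I)\<^sup>2 \<le> L2_set z I * (M0 * (\<beta> * L2_set v K + M0 * L2_set e J))"
      using M0 by (simp add: field_simps)
    then show ?thesis by (rule le_of_square_le) (use M0 \<beta> in auto)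
  qed
  have e_le': "L2_set e J \<le> 2 * M0 * t * L2_set v K"
    using e_le mult_left_mono[OF h_le t(1)] by (simp add: mult_ac)
  have z_le': "L2_set z I \<le> M0 * (\<beta> + 2 * M0\<^sup>2 * t) * L2_set v K"
  proof -
    have "M0 * (\<beta> * L2_set v K + M0 * L2_set e J) \<le> M0 * (\<beta> * L2_set v K + M0 * (2 * M0 * t * L2_set v K))"
      using M0 e_le' by (intro mult_left_mono add_left_mono) auto
    then show ?thesis using z_le by (simp add: algebra_simps power2_eq_square)
  qed
  \<comment> \<open>On the core, the form of \<open>g\<close> is the pairing of \<open>u'\<close>
    with \<open>h\<close>, so \<open>pair\<close> applies. Its leading term is the block of
    \<open>\<omega>\<close>, and the term with \<open>z\<close> gains a factor
    \<open>\<beta>\<close> from \<open>zx\<close>.\<close>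
  have "bilin K g u v = (\<Sum>i\<in>K. u' i * h i)"
    unfolding bilin_def using KJ
    by (intro sum.cong refl) (auto simp: u'_def h_def sum_distrib_left mult.assoc)
  also have "\<dots> = (\<Sum>i\<in>I. u' i * h i)"
    using fin KI by (intro sum.mono_neutral_left) (auto simp: u'_def)
  also have "\<dots> = bilin I \<omega> u' v' + bilin I \<omega> u' e + bilin I \<omega> u' z" by (rule pair)
  also have "bilin I \<omega> u' v' = bilin K \<omega> u v"
    by (subst bilin_superset[OF fin KI]) (auto simp: u'_def v'_def intro!: bilin_cong)
  also have "bilin I \<omega> u' z = bilin I \<omega> z u'" by (rule bilin_commute[OF sym])
  finally have "\<bar>bilin K (\<lambda>i j. g i j - \<omega> i j) u v\<bar> \<le> \<bar>bilin I \<omega> u' e\<bar> + \<bar>bilin I \<omega> z u'\<bar>"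
    unfolding bilin_diff_matrix by linarith
  also have "\<dots> \<le> M0 * L2_set u K * L2_set e J + L2_set z I * (\<beta> * L2_set u K)"
    using zx[of u'] \<omega>_up[of u' e] n eI by (intro add_mono) (auto simp: u'_def[abs_def])
  also have "\<dots> \<le> M0 * L2_set u K * (2 * M0 * t * L2_set v K) +
      M0 * (\<beta> + 2 * M0\<^sup>2 * t) * L2_set v K * (\<beta> * L2_set u K)"
    using M0 \<beta> e_le' z_le' by (intro add_mono mult_left_mono mult_right_mono) auto
  also have "\<dots> = (2 * M0\<^sup>2 * t + \<beta> * M0 * (\<beta> + 2 * M0\<^sup>2 * t)) * L2_set u K * L2_set v K"
    by (simp add: algebra_simps power2_eq_square)
  finally show ?thesis .
qed

text \<open>Schur's test with the image itself as left vector; one factor of its norm then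
  cancels.\<close>

lemma L2_set_apply_on_le_schur:
  assumes fin: "finite I" and KI: "K \<subseteq> I"
    and u: "\<And>i. i \<notin> K \<Longrightarrow> u i = 0"
    and row: "\<And>i. i \<in> R \<Longrightarrow> (\<Sum>j\<in>K. \<bar>A i j\<bar>) \<le> b"
    and col: "\<And>j. j \<in> K \<Longrightarrow> (\<Sum>i\<in>R. \<bar>A i j\<bar>) \<le> b" and b: "b \<ge> 0"
  shows "L2_set (apply_on I A u) R \<le> b * L2_set u K"
proof -
  let ?x = "apply_on I A u"
  have x: "?x i = (\<Sum>j\<in>K. A i j * u j)" for i
    unfolding apply_on_def using fin KI u by (intro sum.mono_neutral_right) auto
  have "?x i * ?x i = (\<Sum>j\<in>K. ?x i * A i j * u j)" for i
    unfolding mult.assoc sum_distrib_left[symmetric] x[symmetric] ..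
  then have "(L2_set ?x R)\<^sup>2 = (\<Sum>i\<in>R. \<Sum>j\<in>K. ?x i * A i j * u j)"
    unfolding L2_set_square by (simp add: power2_eq_square)
  also have "\<dots> \<le> b * L2_set ?x R * L2_set u K"
    using bilin_schur_test[OF row col b, of ?x u] by linarith
  finally have "(L2_set ?x R)\<^sup>2 \<le> L2_set ?x R * (b * L2_set u K)" by (simp only: mult_ac)
  then show ?thesis by (rule le_of_square_le) (use b in auto)
qed

text \<open>After Cauchy-Schwarz over \<open>l\<close> only the sum of the squared norms on the
  blocks matters, and it counts each index at most \<open>m\<close> times. The number of blocks,
  which will be of order p, does not enter.\<close>

lemma bilin_block_sum_le:
  assumes fin: "finite I" "finite L" and sub: "\<And>l. l \<in> L \<Longrightarrow> B l \<subseteq> I"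
    and zero: "\<And>l i j. l \<in> L \<Longrightarrow> i \<in> I \<Longrightarrow> j \<in> I \<Longrightarrow> \<not> (i \<in> B l \<and> j \<in> B l) \<Longrightarrow> E l i j = 0"
    and bound: "\<And>l u v. l \<in> L \<Longrightarrow> \<bar>bilin (B l) (E l) u v\<bar> \<le> \<epsilon> * L2_set u (B l) * L2_set v (B l)"
    and mult: "\<And>i. i \<in> I \<Longrightarrow> card {l \<in> L. i \<in> B l} \<le> m" and \<epsilon>: "\<epsilon> \<ge> 0"
  shows "\<bar>bilin I (\<lambda>i j. \<Sum>l\<in>L. E l i j) u v\<bar> \<le> \<epsilon> * real m * L2_set u I * L2_set v I"
proof -
  have overlap: "L2_set (\<lambda>l. L2_set w (B l)) L \<le> sqrt m * L2_set w I" for w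
  proof -
    have "(\<Sum>l\<in>L. (L2_set w (B l))\<^sup>2) = (\<Sum>l\<in>L. \<Sum>i\<in>I. if i \<in> B l then (w i)\<^sup>2 else 0)"
      unfolding L2_set_square
    proof (rule sum.cong[OF refl])
      fix l assume "l \<in> L"
      then have "B l = I \<inter> B l" using sub by blast
      then show "(\<Sum>i\<in>B l. (w i)\<^sup>2) = (\<Sum>i\<in>I. if i \<in> B l then (w i)\<^sup>2 else 0)"
        using sum.inter_restrict[OF fin(1), of "\<lambda>i. (w i)\<^sup>2" "B l"] by simp
    qed
    also have "\<dots> = (\<Sum>i\<in>I. (w i)\<^sup>2 * real (card {l \<in> L. i \<in> B l}))"
      using fin by (subst sum.swap) (simp add: sum.inter_filter[symmetric] mult.commute)
    also have "\<dots> \<le> (\<Sum>i\<in>I. (w i)\<^sup>2 * real m)" using mult by (intro sum_mono mult_left_mono) auto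
    finally show ?thesis
      unfolding L2_set_def real_sqrt_mult[symmetric]
      by (intro real_sqrt_le_mono) (simp add: sum_distrib_left mult.commute L2_set_def sum_nonneg)
  qed
  have "bilin I (\<lambda>i j. \<Sum>l\<in>L. E l i j) u v = (\<Sum>l\<in>L. bilin I (E l) u v)"
    unfolding bilin_def sum_distrib_left sum_distrib_right
    by (subst (2) sum.swap, subst sum.swap) simp
  also have "\<dots> = (\<Sum>l\<in>L. bilin (B l) (E l) u v)"
  proof (intro sum.cong refl)
    fix l assume l: "l \<in> L"
    have "bilin I (E l) u v = (\<Sum>i\<in>B l. \<Sum>j\<in>I. u i * E l i j * v j)"
      unfolding bilin_def using fin sub[OF l] zero[OF l] by (intro sum.mono_neutral_right) auto
    also have "\<dots> = bilin (B l) (E l) u v"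
      unfolding bilin_def using fin sub[OF l] zero[OF l] by (intro sum.cong sum.mono_neutral_right refl) auto
    finally show "bilin I (E l) u v = bilin (B l) (E l) u v" .
  qed
  also have "\<bar>\<dots>\<bar> \<le> (\<Sum>l\<in>L. \<epsilon> * L2_set u (B l) * L2_set v (B l))"
    by (rule order_trans[OF sum_abs]) (intro sum_mono bound)
  also have "\<dots> = \<epsilon> * (\<Sum>l\<in>L. \<bar>L2_set u (B l)\<bar> * \<bar>L2_set v (B l)\<bar>)" by (simp add: sum_distrib_left mult.assoc)
  also have "\<dots> \<le> \<epsilon> * (L2_set (\<lambda>l. L2_set u (B l)) L * L2_set (\<lambda>l. L2_set v (B l)) L)"
    using \<epsilon> by (intro mult_left_mono L2_set_mult_ineq)
  also have "\<dots> \<le> \<epsilon> * ((sqrt m * L2_set u I) * (sqrt m * L2_set v I))"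
    using \<epsilon> by (intro mult_left_mono mult_mono overlap) auto
  also have "\<dots> = \<epsilon> * real m * L2_set u I * L2_set v I" by (simp add: mult_ac)
  finally show ?thesis .
qed

section \<open>Concentration of the sample covariance\<close>

text \<open>The value of 1 + (sum over k of exp(a(k + 1)) exp(-2ak)), the layerwise bound for the
  exponential moment of a square.\<close>

definition tail_const :: "real \<Rightarrow> real" where
  "tail_const a = 1 + exp a / (1 - exp (- a))"

text \<open>The tail decays at twice the rate at which the integrand grows, which leaves a
  convergent geometric series over the layers k < Y^2 \<le> k + 1.\<close>

lemma nn_integral_exp_square_le:
  fixes Y :: "'a \<Rightarrow> real"
  assumes "prob_space D" and Y[measurable]: "Y \<in> borel_measurable D" and a: "a > 0"
    and tail: "\<And>t. t > 0 \<Longrightarrow> measure D {x \<in> space D. \<bar>Y x\<bar> > t} \<le> exp (- (2 * a * t\<^sup>2))"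
  shows "(\<integral>\<^sup>+x. ennreal (exp (a * (Y x)\<^sup>2)) \<partial>D) \<le> ennreal (tail_const a)"
proof -
  interpret prob_space D by fact
  define A where "A k = {x \<in> space D. \<bar>Y x\<bar> > sqrt (real k)}" for k :: nat
  have A[measurable]: "A k \<in> sets D" for k unfolding A_def by measurable
  define c where "c k = ennreal (exp (a * (real k + 1)))" for k :: nat
  have point: "ennreal (exp (a * (Y x)\<^sup>2)) \<le> 1 + (\<Sum>k. c k * indicator (A k) x)" if x: "x \<in> space D" for x
  proof (cases "Y x = 0")
    case True
    then show ?thesis by simp
  next
    case False
    \<comment> \<open>The layers are open on the left to match the strict inequality in the tail
      bound. A point with \<open>Y x = 0\<close> lies in no layer and is paid for by the summand
      1.\<close>
    define k where "k = nat (\<lceil>(Y x)\<^sup>2\<rceil> - 1)"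
    have "(Y x)\<^sup>2 > 0" using False by simp
    then have k: "real k < (Y x)\<^sup>2" "(Y x)\<^sup>2 \<le> real k + 1" unfolding k_def by linarith+
    from k(1) have "sqrt (real k) < \<bar>Y x\<bar>" using real_sqrt_less_mono by fastforce
    then have "x \<in> A k" using x by (simp add: A_def)
    have "ennreal (exp (a * (Y x)\<^sup>2)) \<le> c k * indicator (A k) x"
      using \<open>x \<in> A k\<close> k(2) a by (simp add: c_def)
    also have "\<dots> = (\<Sum>k\<in>{k}. c k * indicator (A k) x)" by (simp del: sum_mult_indicator)
    also have "\<dots> \<le> (\<Sum>k. c k * indicator (A k) x)" by (rule sum_le_suminf) auto
    also have "\<dots> \<le> 1 + (\<Sum>k. c k * indicator (A k) x)" by simp
    finally show ?thesis .
  qed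
  \<comment> \<open>For k = 0 the tail hypothesis does not apply, but the bound claimed is then
    1.\<close>
  have prob_A: "measure D (A k) \<le> exp (- (2 * a * real k))" for k
    using tail[of "sqrt (real k)"] by (cases "k = 0") (auto simp: A_def)
  have "(\<integral>\<^sup>+x. ennreal (exp (a * (Y x)\<^sup>2)) \<partial>D) \<le> (\<integral>\<^sup>+x. 1 + (\<Sum>k. c k * indicator (A k) x) \<partial>D)"
    by (intro nn_integral_mono point)
  also have "\<dots> = 1 + (\<integral>\<^sup>+x. (\<Sum>k. c k * indicator (A k) x) \<partial>D)"
    by (subst nn_integral_add) (auto simp: emeasure_space_1)
  also have "\<dots> = 1 + (\<Sum>k. c k * emeasure D (A k))"
    by (subst nn_integral_suminf) (auto simp: nn_integral_cmult_indicator)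
  also have "\<dots> \<le> 1 + (\<Sum>k. ennreal (exp a * exp (- a) ^ k))"
  proof (intro add_left_mono suminf_le)
    fix k
    have "c k * emeasure D (A k) = ennreal (exp (a * (real k + 1)) * measure D (A k))"
      by (simp add: c_def emeasure_eq_measure ennreal_mult)
    also have "\<dots> \<le> ennreal (exp (a * (real k + 1)) * exp (- (2 * a * real k)))"
      by (intro ennreal_leI mult_left_mono prob_A) auto
    also have "exp (a * (real k + 1)) * exp (- (2 * a * real k)) = exp a * exp (- a) ^ k"
      by (simp add: exp_of_nat_mult[symmetric] exp_add[symmetric] algebra_simps)
    finally show "c k * emeasure D (A k) \<le> ennreal (exp a * exp (- a) ^ k)" .
  qed auto
  also have "(\<Sum>k. ennreal (exp a * exp (- a) ^ k)) = ennreal (exp a / (1 - exp (- a)))"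
    using a by (intro suminf_ennreal_eq) (auto intro!: sums_mult[of _ "1 / (1 - exp (-a))" "exp a", simplified] geometric_sums)
  also have "1 + ennreal (exp a / (1 - exp (- a))) = ennreal (tail_const a)"
    unfolding tail_const_def using a by (subst ennreal_plus) auto
  finally show ?thesis .
qed

section \<open>Moment generating functions and Chernoff bounds\<close>

lemma exp_le_quadratic: "exp x \<le> 1 + x + x\<^sup>2 / 2 * exp \<bar>x\<bar>" for x :: real
proof -
  obtain t where t: "\<bar>t\<bar> \<le> \<bar>x\<bar>" "exp x = (\<Sum>m<2. x ^ m / fact m) + exp t / fact 2 * x ^ 2"
    using Maclaurin_exp_le[of x 2] by blast
  have "exp t * x\<^sup>2 \<le> exp \<bar>x\<bar> * x\<^sup>2" using t(1) by (intro mult_right_mono) auto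
  then show ?thesis using t(2) by (simp add: numeral_2_eq_2 mult.commute)
qed

text \<open>The coefficient of l^2: W^2 is at most (8 / b^2) exp(b |W| / 2), the Taylor remainder
  halves this, and \<open>K\<close> bounds the exponential moment.\<close>

definition mgf_const :: "real \<Rightarrow> real \<Rightarrow> real" where
  "mgf_const b K = 4 * K / b\<^sup>2"

text \<open>The mean 0 removes the linear Taylor term. Of the exponential moment of order
  \<open>b\<close>, one half pays for W^2 and the other for exp |l W|; hence the limit
  \<open>b / 2\<close> on \<open>l\<close>.\<close>

lemma nn_integral_exp_le:
  fixes W :: "'a \<Rightarrow> real"
  assumes "prob_space D" and W: "integrable D W" and mean: "(\<integral>x. W x \<partial>D) = 0" and b: "b > 0" and K: "K \<ge> 0"
    and expW: "(\<integral>\<^sup>+x. ennreal (exp (b * \<bar>W x\<bar>)) \<partial>D) \<le> ennreal K" and l: "\<bar>l\<bar> \<le> b / 2"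
  shows "(\<integral>\<^sup>+x. ennreal (exp (l * W x)) \<partial>D) \<le> ennreal (exp (mgf_const b K * l\<^sup>2))"
proof -
  interpret prob_space D by fact
  have [measurable]: "W \<in> borel_measurable D" using W by auto
  have int: "integrable D (\<lambda>x. exp (b * \<bar>W x\<bar>))"
    using expW by (intro integrableI_bounded) (auto simp: le_less_trans)
  have EK: "(\<integral>x. exp (b * \<bar>W x\<bar>) \<partial>D) \<le> K"
    using expW K by (subst (asm) nn_integral_eq_integral[OF int]) (auto simp: ennreal_le_iff)
  have point: "exp (l * W x) \<le> 1 + l * W x + 4 * l\<^sup>2 / b\<^sup>2 * exp (b * \<bar>W x\<bar>)" for x
  proof -
    define y where "y = b * \<bar>W x\<bar> / 2"
    have "1 + y + y\<^sup>2 / 2 \<le> exp y" by (rule exp_lower_Taylor_quadratic) (use b in \<open>simp add: y_def\<close>)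
    moreover have "y \<ge> 0" using b by (simp add: y_def)
    ultimately have "y\<^sup>2 / 2 \<le> exp y" by linarith
    moreover have "(W x)\<^sup>2 = 8 / b\<^sup>2 * (y\<^sup>2 / 2)"
      using b by (simp add: y_def power_divide power_mult_distrib)
    ultimately have W2: "(W x)\<^sup>2 \<le> 8 / b\<^sup>2 * exp y" using b by (simp add: divide_right_mono)
    have lW: "exp \<bar>l * W x\<bar> \<le> exp y"
      using mult_right_mono[OF l, of "\<bar>W x\<bar>"] by (simp add: y_def abs_mult)
    have "(l * W x)\<^sup>2 / 2 * exp \<bar>l * W x\<bar> \<le> l\<^sup>2 * (8 / b\<^sup>2 * exp y) / 2 * exp y"
      unfolding power_mult_distrib using W2 lW by (intro mult_mono divide_right_mono mult_left_mono) auto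
    also have "\<dots> = 4 * l\<^sup>2 / b\<^sup>2 * (exp y * exp y)" by simp
    also have "exp y * exp y = exp (b * \<bar>W x\<bar>)" by (simp add: exp_add[symmetric] y_def)
    finally show ?thesis using exp_le_quadratic[of "l * W x"] by linarith
  qed
  have int2: "integrable D (\<lambda>x. 1 + l * W x + 4 * l\<^sup>2 / b\<^sup>2 * exp (b * \<bar>W x\<bar>))"
    using W int by auto
  have "(\<integral>\<^sup>+x. ennreal (exp (l * W x)) \<partial>D) \<le> (\<integral>\<^sup>+x. ennreal (1 + l * W x + 4 * l\<^sup>2 / b\<^sup>2 * exp (b * \<bar>W x\<bar>)) \<partial>D)"
    by (intro nn_integral_mono ennreal_leI point)
  also have "\<dots> = ennreal (\<integral>x. 1 + l * W x + 4 * l\<^sup>2 / b\<^sup>2 * exp (b * \<bar>W x\<bar>) \<partial>D)"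
    using order_trans[OF exp_ge_zero point] by (intro nn_integral_eq_integral[OF int2]) auto
  also have "(\<integral>x. 1 + l * W x + 4 * l\<^sup>2 / b\<^sup>2 * exp (b * \<bar>W x\<bar>) \<partial>D) = 1 + 4 * l\<^sup>2 / b\<^sup>2 * (\<integral>x. exp (b * \<bar>W x\<bar>) \<partial>D)"
    using W int mean by (simp add: prob_space)
  also have "\<dots> \<le> 1 + 4 * l\<^sup>2 / b\<^sup>2 * K" using EK by (intro add_left_mono mult_left_mono) auto
  also have "\<dots> = 1 + mgf_const b K * l\<^sup>2" by (simp add: mgf_const_def)
  also have "\<dots> \<le> exp (mgf_const b K * l\<^sup>2)" by (rule exp_ge_add_one_self)
  finally show ?thesis by (simp add: ennreal_leI)
qed

lemma chernoff_one_sided: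
  fixes W :: "'a \<Rightarrow> real" and n :: nat
  assumes "prob_space D" and W[measurable]: "W \<in> borel_measurable D"
    and c: "c > 0" and b: "b > 0"
    and mgf: "\<And>l. \<bar>l\<bar> \<le> b / 2 \<Longrightarrow> (\<integral>\<^sup>+x. ennreal (exp (l * W x)) \<partial>D) \<le> ennreal (exp (c * l\<^sup>2))"
    and r: "0 < r" "r \<le> c * b"
  defines "P \<equiv> Pi\<^sub>M {..<n} (\<lambda>_. D)"
  shows "emeasure P {X \<in> space P. (\<Sum>s<n. W (X s)) \<ge> real n * r} \<le> ennreal (exp (- (real n * r\<^sup>2 / (4 * c))))"
proof -
  interpret prob_space D by fact
  interpret product_sigma_finite "\<lambda>_::nat. D" by (simp add: product_sigma_finite_def sigma_finite_measure_axioms)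
  \<comment> \<open>The minimiser of the exponent c l^2 - l r. The condition
    \<open>r \<le> c * b\<close> is exactly what keeps it within \<open>b / 2\<close>.\<close>
  define l where "l = r / (2 * c)"
  have l: "0 < l" "\<bar>l\<bar> \<le> b / 2" using r c by (auto simp: l_def field_simps)
  have [measurable]: "(\<lambda>X. W (X s)) \<in> borel_measurable P" if "s < n" for s
    unfolding P_def using that by (intro measurable_compose[OF _ W] measurable_component_singleton) auto
  let ?A = "{X \<in> space P. (\<Sum>s<n. W (X s)) \<ge> real n * r}"
  have A[measurable]: "?A \<in> sets P" by measurable
  have "emeasure P ?A = (\<integral>\<^sup>+X. indicator ?A X \<partial>P)" by simp
  also have "\<dots> \<le> (\<integral>\<^sup>+X. (\<Prod>s<n. ennreal (exp (l * (W (X s) - r)))) \<partial>P)"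
  proof (intro nn_integral_mono)
    fix X assume "X \<in> space P"
    have "(\<Prod>s<n. ennreal (exp (l * (W (X s) - r)))) = ennreal (exp (l * ((\<Sum>s<n. W (X s)) - real n * r)))"
      by (simp add: prod_ennreal exp_sum[symmetric] sum_distrib_left[symmetric] sum_subtractf)
    moreover have "1 \<le> exp (l * ((\<Sum>s<n. W (X s)) - real n * r))" if "X \<in> ?A" using that l by simp
    ultimately show "indicator ?A X \<le> (\<Prod>s<n. ennreal (exp (l * (W (X s) - r))))"
      by (auto simp: indicator_def simp flip: ennreal_1 intro!: ennreal_leI)
  qed
  also have "\<dots> = (\<Prod>s<n. \<integral>\<^sup>+x. ennreal (exp (l * (W x - r))) \<partial>D)"
    unfolding P_def by (intro product_nn_integral_prod) auto
  also have "\<dots> \<le> (\<Prod>s<n. ennreal (exp (- (r\<^sup>2 / (4 * c)))))"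
    unfolding prod_constant
  proof (rule power_mono)
    have "(\<integral>\<^sup>+x. ennreal (exp (l * (W x - r))) \<partial>D) = (\<integral>\<^sup>+x. ennreal (exp (- (l * r))) * ennreal (exp (l * W x)) \<partial>D)"
      by (intro nn_integral_cong) (simp add: ennreal_mult[symmetric] exp_add[symmetric] algebra_simps)
    also have "\<dots> = ennreal (exp (- (l * r))) * (\<integral>\<^sup>+x. ennreal (exp (l * W x)) \<partial>D)"
      by (intro nn_integral_cmult) auto
    also have "\<dots> \<le> ennreal (exp (- (l * r))) * ennreal (exp (c * l\<^sup>2))" by (intro mult_left_mono mgf l) auto
    also have "\<dots> = ennreal (exp (c * l\<^sup>2 - l * r))" by (simp add: ennreal_mult[symmetric] exp_add[symmetric])
    also have "c * l\<^sup>2 - l * r = - (r\<^sup>2 / (4 * c))" using c by (simp add: l_def power2_eq_square field_simps)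
    finally show "(\<integral>\<^sup>+x. ennreal (exp (l * (W x - r))) \<partial>D) \<le> ennreal (exp (- (r\<^sup>2 / (4 * c))))" .
  qed auto
  also have "\<dots> = ennreal (exp (- (real n * r\<^sup>2 / (4 * c))))"
    by (simp add: ennreal_power exp_of_nat_mult[symmetric])
  finally show ?thesis .
qed

lemma chernoff_two_sided:
  fixes W :: "'a \<Rightarrow> real" and n :: nat
  assumes D: "prob_space D" and W[measurable]: "W \<in> borel_measurable D"
    and c: "c > 0" and b: "b > 0"
    and mgf: "\<And>l. \<bar>l\<bar> \<le> b / 2 \<Longrightarrow> (\<integral>\<^sup>+x. ennreal (exp (l * W x)) \<partial>D) \<le> ennreal (exp (c * l\<^sup>2))"
    and r: "0 < r" "r \<le> c * b"
  defines "P \<equiv> Pi\<^sub>M {..<n} (\<lambda>_. D)"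
  shows "{X \<in> space P. \<bar>\<Sum>s<n. W (X s)\<bar> \<ge> real n * r} \<in> sets P"
    and "emeasure P {X \<in> space P. \<bar>\<Sum>s<n. W (X s)\<bar> \<ge> real n * r}
      \<le> ennreal (2 * exp (- (real n * r\<^sup>2 / (4 * c))))"
proof -
  have [measurable]: "(\<lambda>X. W (X s)) \<in> borel_measurable P" if "s < n" for s
    unfolding P_def using that by (intro measurable_compose[OF _ W] measurable_component_singleton) auto
  show "{X \<in> space P. \<bar>\<Sum>s<n. W (X s)\<bar> \<ge> real n * r} \<in> sets P" by measurable
  let ?A = "{X \<in> space P. (\<Sum>s<n. W (X s)) \<ge> real n * r}"
  let ?B = "{X \<in> space P. (\<Sum>s<n. - W (X s)) \<ge> real n * r}"
  have [measurable]: "?A \<in> sets P" "?B \<in> sets P" by measurable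
  have "emeasure P {X \<in> space P. \<bar>\<Sum>s<n. W (X s)\<bar> \<ge> real n * r} \<le> emeasure P (?A \<union> ?B)"
    by (intro emeasure_mono) (auto simp: sum_negf)
  also have "\<dots> \<le> emeasure P ?A + emeasure P ?B" by (rule emeasure_subadditive) auto
  \<comment> \<open>The range of \<open>l\<close> in \<open>mgf\<close> is symmetric, so the
    one-sided bound applies to -W as well.\<close>
  also have "\<dots> \<le> ennreal (exp (- (real n * r\<^sup>2 / (4 * c)))) + ennreal (exp (- (real n * r\<^sup>2 / (4 * c))))"
    unfolding P_def
    using mgf[of "- l" for l] by (intro add_mono chernoff_one_sided[OF D _ c b _ r] mgf) auto
  also have "\<dots> = ennreal (2 * exp (- (real n * r\<^sup>2 / (4 * c))))" by (simp flip: ennreal_plus)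
  finally show "emeasure P {X \<in> space P. \<bar>\<Sum>s<n. W (X s)\<bar> \<ge> real n * r}
      \<le> ennreal (2 * exp (- (real n * r\<^sup>2 / (4 * c))))" .
qed

section \<open>Centred linear forms of the observations\<close>

definition centered_form :: "nat \<Rightarrow> (nat \<Rightarrow> real) measure \<Rightarrow> (nat \<Rightarrow> real) \<Rightarrow> (nat \<Rightarrow> real) \<Rightarrow> real" where
  "centered_form p D w x = (\<Sum>i<p. w i * (x i - mean_vec p D $ i))"

abbreviation entries :: "real Matrix.mat \<Rightarrow> nat \<Rightarrow> nat \<Rightarrow> real" where
  "entries A \<equiv> \<lambda>i j. A $$ (i, j)"

lemma P_classD:
  assumes "D \<in> P_class \<alpha> M0 M \<rho> p"
  shows "prob_space D" "sets D = sets (borel_vec p)" "\<And>i. i < p \<Longrightarrow> integrable D (\<lambda>x. (x i)\<^sup>2)"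
    "invertible_mat (cov_mat p D)" "precision_mat p D \<in> F_class \<alpha> M0 M p" "subgaussian \<rho> p D"
  using assms by (auto simp: P_class_def)

lemma measurable_coordinate:
  assumes "sets D = sets (borel_vec p)" "i < p"
  shows "(\<lambda>x. x i) \<in> borel_measurable D"
  using measurable_component_singleton[of i "{..<p}" "\<lambda>_. borel"] assms
  by (simp cong: measurable_cong_sets)

lemma centered_form_moments:
  assumes D: "prob_space D" and sets_D: "sets D = sets (borel_vec p)"
    and sq: "\<And>i. i < p \<Longrightarrow> integrable D (\<lambda>x. (x i)\<^sup>2)"
  shows "integrable D (centered_form p D w)" "(\<integral>x. centered_form p D w x \<partial>D) = 0"
    "integrable D (\<lambda>x. (centered_form p D w x)\<^sup>2)"
    "(\<integral>x. (centered_form p D w x)\<^sup>2 \<partial>D) = bilin {..<p} (entries (cov_mat p D)) w w"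
proof -
  interpret prob_space D by fact
  define \<mu> where "\<mu> i = mean_vec p D $ i" for i
  have \<mu>: "\<mu> i = (\<integral>x. x i \<partial>D)" if "i < p" for i using that by (simp add: \<mu>_def mean_vec_def)
  note meas[measurable] = measurable_coordinate[OF sets_D]
  have int: "integrable D (\<lambda>x. x i)" if "i < p" for i
    using square_integrable_imp_integrable[OF meas sq] that by blast
  have c: "centered_form p D w = (\<lambda>x. \<Sum>i<p. w i * (x i - \<mu> i))"
    by (simp add: centered_form_def \<mu>_def fun_eq_iff)
  have int_c: "integrable D (\<lambda>x. w i * (x i - \<mu> i))" if "i < p" for i using int[OF that] by auto
  show "integrable D (centered_form p D w)" unfolding c using int_c by auto
  have "(\<integral>x. centered_form p D w x \<partial>D) = (\<Sum>i<p. \<integral>x. w i * (x i - \<mu> i) \<partial>D)"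
    unfolding c using int_c by (intro Bochner_Integration.integral_sum) auto
  also have "\<dots> = 0" using int \<mu> by (intro sum.neutral) (auto simp: prob_space)
  finally show "(\<integral>x. centered_form p D w x \<partial>D) = 0" .
  have sq_c: "integrable D (\<lambda>x. (x i - \<mu> i)\<^sup>2)" if "i < p" for i
    unfolding power2_diff using sq[OF that] int[OF that] by auto
  have prod_c: "integrable D (\<lambda>x. (x i - \<mu> i) * (x j - \<mu> j))" if "i < p" "j < p" for i j
  proof (rule Bochner_Integration.integrable_bound)
    show "integrable D (\<lambda>x. (x i - \<mu> i)\<^sup>2 + (x j - \<mu> j)\<^sup>2)" using sq_c that by auto
    show "AE x in D. norm ((x i - \<mu> i) * (x j - \<mu> j)) \<le> norm ((x i - \<mu> i)\<^sup>2 + (x j - \<mu> j)\<^sup>2)"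
    proof (rule AE_I2)
      fix x
      have "2 * \<bar>x i - \<mu> i\<bar> * \<bar>x j - \<mu> j\<bar> \<le> (x i - \<mu> i)\<^sup>2 + (x j - \<mu> j)\<^sup>2"
        using sum_squares_bound[of "\<bar>x i - \<mu> i\<bar>" "\<bar>x j - \<mu> j\<bar>"] by simp
      moreover have "0 \<le> \<bar>x i - \<mu> i\<bar> * \<bar>x j - \<mu> j\<bar>" by simp
      ultimately show "norm ((x i - \<mu> i) * (x j - \<mu> j)) \<le> norm ((x i - \<mu> i)\<^sup>2 + (x j - \<mu> j)\<^sup>2)"
        unfolding real_norm_def abs_mult by linarith
    qed
  qed (use that in measurable)
  have square: "(centered_form p D w x)\<^sup>2 = (\<Sum>i<p. \<Sum>j<p. w i * w j * ((x i - \<mu> i) * (x j - \<mu> j)))" for x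
    unfolding c power2_eq_square sum_product by (intro sum.cong refl) (simp add: mult_ac)
  have prod_cw: "integrable D (\<lambda>x. w i * w j * ((x i - \<mu> i) * (x j - \<mu> j)))" if "i < p" "j < p" for i j
    using prod_c[OF that] by auto
  show "integrable D (\<lambda>x. (centered_form p D w x)\<^sup>2)" unfolding square by (intro Bochner_Integration.integrable_sum prod_cw) auto
  have "(\<integral>x. (centered_form p D w x)\<^sup>2 \<partial>D) = (\<Sum>i<p. \<Sum>j<p. \<integral>x. w i * w j * ((x i - \<mu> i) * (x j - \<mu> j)) \<partial>D)"
    unfolding square using prod_cw
    by (subst Bochner_Integration.integral_sum, force, intro sum.cong refl Bochner_Integration.integral_sum) auto
  also have "\<dots> = bilin {..<p} (entries (cov_mat p D)) w w"
    unfolding bilin_def by (intro sum.cong refl) (simp add: cov_mat_def \<mu>_def)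
  finally show "(\<integral>x. (centered_form p D w x)\<^sup>2 \<partial>D) = bilin {..<p} (entries (cov_mat p D)) w w" .
qed

lemma centered_form_tail:
  assumes sub: "subgaussian \<rho> p D" and w: "L2_set w {..<p} = 1" and t: "t > 0"
  shows "measure D {x \<in> space D. \<bar>centered_form p D w x\<bar> > t} \<le> exp (- (t\<^sup>2 * \<rho> / 2))"
proof -
  let ?v = "Matrix.vec p w"
  have "scalar_prod ?v ?v = (L2_set w {..<p})\<^sup>2"
    unfolding L2_set_square by (simp add: scalar_prod_def power2_eq_square lessThan_atLeast0)
  then have "scalar_prod ?v ?v = 1" using w by simp
  moreover have "scalar_prod ?v (Matrix.vec p x - mean_vec p D) = centered_form p D w x" for x
    by (simp add: scalar_prod_def centered_form_def mean_vec_def lessThan_atLeast0)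
  ultimately show ?thesis
    using sub t unfolding subgaussian_def by (auto dest!: bspec[of _ _ ?v])
qed

text \<open>An empirical variance may be computed about any centre, here the mean under
  \<open>D\<close>, once the squared average of the shifted values is subtracted. Both sums on the
  right run over functions of single observations, as the Chernoff bound requires.\<close>

lemma sample_cov_form:
  assumes n: "n \<ge> 1"
  shows "bilin {..<p} (entries (sample_cov n p X)) w w =
    (\<Sum>s<n. (centered_form p D w (X s))\<^sup>2) / real n - ((\<Sum>s<n. centered_form p D w (X s)) / real n)\<^sup>2"
proof -
  define Y where "Y s = centered_form p D w (X s)" for s
  define m where "m = (\<Sum>s<n. Y s) / real n"
  have m: "m = (\<Sum>i<p. w i * (sample_mean n X i - mean_vec p D $ i))"
  proof -
    have "(\<Sum>s<n. Y s) = (\<Sum>i<p. w i * (\<Sum>s<n. X s i - mean_vec p D $ i))"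
      unfolding Y_def centered_form_def by (subst sum.swap) (simp add: sum_distrib_left)
    also have "\<dots> = real n * (\<Sum>i<p. w i * (sample_mean n X i - mean_vec p D $ i))"
    proof -
      have "(\<Sum>s<n. X s i - mean_vec p D $ i) = real n * (sample_mean n X i - mean_vec p D $ i)" for i
        using n by (simp add: sample_mean_def sum_subtractf right_diff_distrib)
      then show ?thesis by (simp add: sum_distrib_left mult_ac)
    qed
    finally show ?thesis using n by (simp add: m_def)
  qed
  have Ym: "(\<Sum>i<p. w i * (X s i - sample_mean n X i)) = Y s - m" for s
    unfolding m Y_def centered_form_def sum_subtractf[symmetric]
    by (intro sum.cong refl) (simp add: algebra_simps)
  have "bilin {..<p} (entries (sample_cov n p X)) w w =
      (\<Sum>i<p. \<Sum>j<p. \<Sum>s<n. (w i * (X s i - sample_mean n X i)) * (w j * (X s j - sample_mean n X j)) / real n)"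
    unfolding bilin_def
    by (intro sum.cong refl) (simp add: sample_cov_def sum_divide_distrib sum_distrib_left sum_distrib_right mult_ac)
  also have "\<dots> = (\<Sum>i<p. \<Sum>s<n. \<Sum>j<p. (w i * (X s i - sample_mean n X i)) * (w j * (X s j - sample_mean n X j)) / real n)"
    by (rule sum.cong[OF refl], rule sum.swap)
  also have "\<dots> = (\<Sum>s<n. \<Sum>i<p. \<Sum>j<p. (w i * (X s i - sample_mean n X i)) * (w j * (X s j - sample_mean n X j)) / real n)" by (rule sum.swap)
  also have "\<dots> = (\<Sum>s<n. (\<Sum>i<p. \<Sum>j<p. (w i * (X s i - sample_mean n X i)) * (w j * (X s j - sample_mean n X j))) / real n)"
    by (simp add: sum_divide_distrib)
  also have "\<dots> = (\<Sum>s<n. (Y s - m)\<^sup>2) / real n"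
    unfolding sum_product[symmetric] Ym by (simp add: power2_eq_square sum_divide_distrib)
  also have "(\<Sum>s<n. (Y s - m)\<^sup>2) = (\<Sum>s<n. (Y s)\<^sup>2) - 2 * m * (\<Sum>s<n. Y s) + real n * m\<^sup>2"
    by (simp add: power2_diff sum.distrib sum_subtractf sum_distrib_left mult_ac)
  also have "(\<Sum>s<n. Y s) = real n * m" using n by (simp add: m_def)
  finally have "bilin {..<p} (entries (sample_cov n p X)) w w = (\<Sum>s<n. (Y s)\<^sup>2) / real n - m\<^sup>2"
    using n by (simp add: field_simps power2_eq_square)
  then show ?thesis by (simp add: Y_def m_def)
qed

text \<open>With a = \<rho> / 4 the subgaussian tail reads exp(-2 a t^2). For K =
  \<open>tail_const a\<close>, the product exp(K) K bounds the exponential moment of order a both of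
  the linear form and of its centred square, so that one constant serves the two Chernoff
  bounds.\<close>

definition deviation_const :: "real \<Rightarrow> real" where
  "deviation_const \<rho> = mgf_const (\<rho> / 4) (exp (tail_const (\<rho> / 4)) * tail_const (\<rho> / 4))"

lemma tail_const_ge: "a > 0 \<Longrightarrow> tail_const a \<ge> a" "a > 0 \<Longrightarrow> tail_const a \<ge> 1"
proof -
  assume a: "a > 0"
  have "exp a \<le> exp a / (1 - exp (- a))" using a by (simp add: field_simps)
  moreover have "1 + a \<le> exp a" by (rule exp_ge_add_one_self)
  ultimately have "1 + a \<le> exp a / (1 - exp (- a))" by linarith
  then show "tail_const a \<ge> a" "tail_const a \<ge> 1" using a unfolding tail_const_def by linarith+
qed

lemma deviation_const_pos: "\<rho> > 0 \<Longrightarrow> deviation_const \<rho> > 0"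
  using tail_const_ge(2)[of "\<rho> / 4"] by (auto simp: deviation_const_def mgf_const_def)

lemma centered_form_mgf:
  assumes D: "D \<in> P_class \<alpha> M0 M \<rho> p" and \<rho>: "\<rho> > 0" and w: "L2_set w {..<p} = 1"
    and l: "\<bar>l\<bar> \<le> \<rho> / 4 / 2"
  defines "Y \<equiv> centered_form p D w"
  defines "m \<equiv> \<integral>x. (Y x)\<^sup>2 \<partial>D"
  shows "(\<integral>\<^sup>+x. ennreal (exp (l * Y x)) \<partial>D) \<le> ennreal (exp (deviation_const \<rho> * l\<^sup>2))"
    "(\<integral>\<^sup>+x. ennreal (exp (l * ((Y x)\<^sup>2 - m))) \<partial>D) \<le> ennreal (exp (deviation_const \<rho> * l\<^sup>2))"
proof -
  note P = P_classD[OF D]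
  interpret prob_space D by (rule P)
  define a where "a = \<rho> / 4"
  define K where "K = tail_const a"
  have a: "a > 0" using \<rho> by (simp add: a_def)
  have K: "K \<ge> a" "K \<ge> 1" using tail_const_ge[OF a] by (auto simp: K_def)
  note mom = centered_form_moments[OF P(1-3), of w, folded Y_def]
  have [measurable]: "Y \<in> borel_measurable D" using mom(1) by auto
  have sq: "(\<integral>\<^sup>+x. ennreal (exp (a * (Y x)\<^sup>2)) \<partial>D) \<le> ennreal K"
    unfolding K_def
  proof (rule nn_integral_exp_square_le[OF P(1) _ a])
    fix t :: real assume "t > 0"
    then show "measure D {x \<in> space D. \<bar>Y x\<bar> > t} \<le> exp (- (2 * a * t\<^sup>2))"
      using centered_form_tail[OF P(6) w, of t] by (simp add: Y_def a_def mult.commute)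
  qed auto
  have m0: "m \<ge> 0" unfolding m_def by (rule integral_nonneg_AE) auto
  \<comment> \<open>From y \<le> exp y under the integral. The variance is thus controlled by the
    tail alone, and centring the square by \<open>m\<close> costs at most a factor exp K.\<close>
  have am: "a * m \<le> K"
  proof -
    have "ennreal (a * m) = (\<integral>\<^sup>+x. ennreal (a * (Y x)\<^sup>2) \<partial>D)"
      using mom(3) a by (subst nn_integral_eq_integral) (auto simp: m_def)
    also have "\<dots> \<le> (\<integral>\<^sup>+x. ennreal (exp (a * (Y x)\<^sup>2)) \<partial>D)"
      by (intro nn_integral_mono ennreal_leI order_trans[OF _ exp_ge_add_one_self]) auto
    also note sq
    finally show ?thesis using K by (simp add: ennreal_le_iff)
  qed
  have bound: "(\<integral>\<^sup>+x. ennreal (exp c * exp (a * (Y x)\<^sup>2)) \<partial>D) \<le> ennreal (exp K * K)" if c: "c \<le> K" for c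
  proof -
    have "(\<integral>\<^sup>+x. ennreal (exp c * exp (a * (Y x)\<^sup>2)) \<partial>D) = ennreal (exp c) * (\<integral>\<^sup>+x. ennreal (exp (a * (Y x)\<^sup>2)) \<partial>D)"
      by (subst nn_integral_cmult[symmetric]) (auto simp: ennreal_mult)
    also have "\<dots> \<le> ennreal (exp K) * ennreal K" using c by (intro mult_mono sq ennreal_leI) auto
    finally show ?thesis using K by (simp add: ennreal_mult)
  qed
  have exp_Y: "(\<integral>\<^sup>+x. ennreal (exp (a * \<bar>Y x\<bar>)) \<partial>D) \<le> ennreal (exp K * K)"
  proof (rule order_trans[OF nn_integral_mono bound[OF K(1)]])
    fix x
    have "2 * \<bar>Y x\<bar> \<le> 1 + (Y x)\<^sup>2" using sum_squares_bound[of 1 "\<bar>Y x\<bar>"] by simp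
    then have "\<bar>Y x\<bar> \<le> 1 + (Y x)\<^sup>2" by linarith
    then have "a * \<bar>Y x\<bar> \<le> a * (1 + (Y x)\<^sup>2)" using a by (intro mult_left_mono) auto
    then show "ennreal (exp (a * \<bar>Y x\<bar>)) \<le> ennreal (exp a * exp (a * (Y x)\<^sup>2))"
      by (intro ennreal_leI) (simp add: exp_add[symmetric] algebra_simps)
  qed
  have exp_Y2: "(\<integral>\<^sup>+x. ennreal (exp (a * \<bar>(Y x)\<^sup>2 - m\<bar>)) \<partial>D) \<le> ennreal (exp K * K)"
  proof (rule order_trans[OF nn_integral_mono bound[OF am]])
    fix x
    have "\<bar>(Y x)\<^sup>2 - m\<bar> \<le> m + (Y x)\<^sup>2" using m0 by (simp add: abs_le_iff)
    then have "a * \<bar>(Y x)\<^sup>2 - m\<bar> \<le> a * (m + (Y x)\<^sup>2)" using a by (intro mult_left_mono) auto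
    then show "ennreal (exp (a * \<bar>(Y x)\<^sup>2 - m\<bar>)) \<le> ennreal (exp (a * m) * exp (a * (Y x)\<^sup>2))"
      by (intro ennreal_leI) (simp add: exp_add[symmetric] algebra_simps)
  qed
  have l': "\<bar>l\<bar> \<le> a / 2" using l by (simp add: a_def)
  have KK: "exp K * K \<ge> 0" using K by simp
  show "(\<integral>\<^sup>+x. ennreal (exp (l * Y x)) \<partial>D) \<le> ennreal (exp (deviation_const \<rho> * l\<^sup>2))"
    using nn_integral_exp_le[OF P(1) mom(1,2) a KK exp_Y l'] by (simp add: deviation_const_def K_def a_def)
  have "integrable D (\<lambda>x. (Y x)\<^sup>2 - m)" using mom(3) by auto
  moreover have "(\<integral>x. (Y x)\<^sup>2 - m \<partial>D) = 0" using mom(3) by (simp add: m_def prob_space)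
  ultimately show "(\<integral>\<^sup>+x. ennreal (exp (l * ((Y x)\<^sup>2 - m))) \<partial>D) \<le> ennreal (exp (deviation_const \<rho> * l\<^sup>2))"
    using nn_integral_exp_le[OF P(1) _ _ a KK exp_Y2 l'] by (simp add: deviation_const_def K_def a_def)
qed

lemma sample_cov_deviation_unit:
  fixes n :: nat
  assumes D: "D \<in> P_class \<alpha> M0 M \<rho> p" and \<rho>: "\<rho> > 0" and w: "L2_set w {..<p} = 1"
    and n: "n \<ge> 1" and r: "0 < r" "r \<le> 1" "r \<le> deviation_const \<rho> * (\<rho> / 4)"
  defines "P \<equiv> Pi\<^sub>M {..<n} (\<lambda>_. D)"
  shows "\<exists>B\<in>sets P. emeasure P B \<le> ennreal (4 * exp (- (real n * r\<^sup>2 / (4 * deviation_const \<rho>)))) \<and>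
    (\<forall>X\<in>space P - B. \<bar>bilin {..<p} (\<lambda>i j. sample_cov n p X $$ (i, j) - cov_mat p D $$ (i, j)) w w\<bar> \<le> 2 * r)"
proof -
  note PD = P_classD[OF D]
  define Y where "Y = centered_form p D w"
  define m where "m = (\<integral>x. (Y x)\<^sup>2 \<partial>D)"
  note mom = centered_form_moments[OF PD(1-3), of w, folded Y_def]
  have m: "m = bilin {..<p} (entries (cov_mat p D)) w w" unfolding m_def by (rule mom(4))
  note mgf = centered_form_mgf[OF D \<rho> w, folded Y_def, folded m_def]
  have [measurable]: "Y \<in> borel_measurable D" using mom(1) by auto
  have b: "\<rho> / 4 > 0" using \<rho> by simp
  note c = deviation_const_pos[OF \<rho>]
  let ?B1 = "{X \<in> space P. \<bar>\<Sum>s<n. Y (X s)\<bar> \<ge> real n * r}"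
  let ?B2 = "{X \<in> space P. \<bar>\<Sum>s<n. (Y (X s))\<^sup>2 - m\<bar> \<ge> real n * r}"
  let ?e = "exp (- (real n * r\<^sup>2 / (4 * deviation_const \<rho>)))"
  have B1: "?B1 \<in> sets P" "emeasure P ?B1 \<le> ennreal (2 * ?e)"
    unfolding P_def by (rule chernoff_two_sided[OF PD(1) _ c b mgf(1) r(1,3)]; simp)+
  have B2: "?B2 \<in> sets P" "emeasure P ?B2 \<le> ennreal (2 * ?e)"
    unfolding P_def by (rule chernoff_two_sided[OF PD(1) _ c b mgf(2) r(1,3)]; simp)+
  have "emeasure P (?B1 \<union> ?B2) \<le> ennreal (2 * ?e) + ennreal (2 * ?e)"
    by (rule order_trans[OF emeasure_subadditive add_mono]) (use B1 B2 in auto)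
  also have "\<dots> = ennreal (4 * ?e)" by (simp flip: ennreal_plus)
  finally have small: "emeasure P (?B1 \<union> ?B2) \<le> ennreal (4 * ?e)" .
  have "\<bar>bilin {..<p} (\<lambda>i j. sample_cov n p X $$ (i, j) - cov_mat p D $$ (i, j)) w w\<bar> \<le> 2 * r"
    if X: "X \<in> space P - (?B1 \<union> ?B2)" for X
  proof -
    define S1 where "S1 = (\<Sum>s<n. Y (X s))"
    define S2 where "S2 = (\<Sum>s<n. (Y (X s))\<^sup>2 - m)"
    have S: "\<bar>S1\<bar> < real n * r" "\<bar>S2\<bar> < real n * r" using X by (auto simp: S1_def S2_def)
    have "bilin {..<p} (\<lambda>i j. sample_cov n p X $$ (i, j) - cov_mat p D $$ (i, j)) w w = S2 / real n - (S1 / real n)\<^sup>2"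
      unfolding bilin_diff_matrix sample_cov_form[OF n, of p X w D] S1_def S2_def
      using n unfolding Y_def[symmetric] m[symmetric]
      by (simp add: sum_subtractf field_simps)
    moreover have "\<bar>S2 / real n\<bar> \<le> r" using S(2) n by (simp add: field_simps abs_divide)
    \<comment> \<open>The restriction r \<le> 1 turns the squared average, of size r^2, into another
      contribution of size r.\<close>
    moreover have "(S1 / real n)\<^sup>2 \<le> r"
    proof -
      have "\<bar>S1 / real n\<bar> \<le> r" using S(1) n by (simp add: field_simps abs_divide)
      then have "(S1 / real n)\<^sup>2 \<le> r\<^sup>2" using r(1) by (simp add: abs_le_square_iff[symmetric])
      also have "\<dots> \<le> r" using r by (simp add: power2_eq_square mult_left_le)
      finally show ?thesis .
    qed
    moreover have "0 \<le> (S1 / real n)\<^sup>2" by simp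
    ultimately show ?thesis by linarith
  qed
  then show ?thesis using small B1(1) B2(1) by (intro bexI[of _ "?B1 \<union> ?B2"]) auto
qed

section \<open>Inverses and eigenvalues\<close>

lemma inv_mat_inverse:
  assumes A: "A \<in> carrier_mat n n" and det: "det A \<noteq> 0"
  shows "inv_mat A \<in> carrier_mat n n" "A * inv_mat A = 1\<^sub>m n" "inv_mat A * A = 1\<^sub>m n"
proof -
  have "mat_inverse A \<noteq> None"
    using det_non_zero_imp_unit[OF A det, of undefined] mat_inverse(1)[OF A, of undefined] by auto
  then obtain B where "mat_inverse A = Some B" by auto
  with mat_inverse(2)[OF A this] show "inv_mat A \<in> carrier_mat n n" "A * inv_mat A = 1\<^sub>m n" "inv_mat A * A = 1\<^sub>m n"
    by (auto simp: inv_mat_def)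
qed

lemma invertible_mat_det_nonzero:
  assumes A: "A \<in> carrier_mat n n" and inv: "invertible_mat A"
  shows "det A \<noteq> (0 :: real)"
proof -
  from inv obtain B where B: "A * B = 1\<^sub>m (dim_row A)" "B * A = 1\<^sub>m (dim_row B)"
    unfolding invertible_mat_def inverts_mat_def by auto
  have "dim_row (A * B) = n" "dim_col (A * B) = n" using A B(1) by auto
  moreover have "dim_col (B * A) = dim_row B" using B(2) by auto
  ultimately have "B \<in> carrier_mat n n" using A by auto
  then have "det A * det B = 1" using B(1) A det_mult[OF A, of B] by simp
  then show ?thesis by auto
qed

lemma mat_mult_entry:
  assumes "A \<in> carrier_mat n n" "B \<in> carrier_mat n n" "i < n" "k < n"
  shows "(A * B) $$ (i, k) = (\<Sum>j<n. A $$ (i, j) * B $$ (j, k))"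
  using assms by (simp add: scalar_prod_def lessThan_atLeast0)

text \<open>Provides the hypothesis \<open>inv\<close> of \<open>rayleigh_lower_bound\<close> for
  the entries of a matrix.\<close>

lemma char_matrix_left_inverse:
  fixes A :: "real Matrix.mat"
  assumes A: "A \<in> carrier_mat n n" and e: "\<not> eigenvalue A e"
  shows "\<exists>R. \<forall>y. \<forall>i\<in>{..<n}. apply_on {..<n} R (\<lambda>i. apply_on {..<n} (entries A) y i - e * y i) i = y i"
proof -
  let ?C = "char_matrix A e"
  have C: "?C \<in> carrier_mat n n" using A by simp
  have "det ?C \<noteq> 0" using e eigenvalue_det[OF A] by simp
  note inv = inv_mat_inverse[OF C this]
  have Centry: "?C $$ (i, j) = A $$ (i, j) - (if i = j then e else 0)" if "i < n" "j < n" for i j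
    using A that by (auto simp: char_matrix_def)
  have "apply_on {..<n} (entries (inv_mat ?C)) (\<lambda>i. apply_on {..<n} (entries A) y i - e * y i) i = y i"
    if i: "i < n" for y i
  proof -
    have "apply_on {..<n} (entries A) y a - e * y a = (\<Sum>j<n. ?C $$ (a, j) * y j)" if a: "a < n" for a
    proof -
      have "(\<Sum>j<n. ?C $$ (a, j) * y j) = apply_on {..<n} (entries A) y a - (\<Sum>j<n. if a = j then e * y j else 0)"
        unfolding apply_on_def sum_subtractf[symmetric]
        using a by (intro sum.cong refl) (auto simp: Centry algebra_simps)
      then show ?thesis using a by simp
    qed
    then have "apply_on {..<n} (entries (inv_mat ?C)) (\<lambda>i. apply_on {..<n} (entries A) y i - e * y i) i =
        (\<Sum>a<n. \<Sum>j<n. inv_mat ?C $$ (i, a) * ?C $$ (a, j) * y j)"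
      unfolding apply_on_def[of _ "entries (inv_mat ?C)"] by (simp add: sum_distrib_left mult.assoc)
    also have "\<dots> = (\<Sum>j<n. (inv_mat ?C * ?C) $$ (i, j) * y j)"
      by (subst sum.swap) (use i in \<open>simp add: mat_mult_entry[OF inv(1) C] sum_distrib_right\<close>)
    also have "\<dots> = (\<Sum>j<n. if i = j then y j else 0)"
      unfolding inv(3) using i by (intro sum.cong refl) auto
    finally show ?thesis using i by simp
  qed
  then show ?thesis by blast
qed

lemma quadratic_bounds_of_eigenvalues:
  fixes A :: "real Matrix.mat"
  assumes A: "A \<in> carrier_mat n n" and sym: "A\<^sup>T = A"
    and ev: "\<And>e. eigenvalue A e \<Longrightarrow> lo \<le> e \<and> e \<le> hi"
  shows "lo * (L2_set v {..<n})\<^sup>2 \<le> bilin {..<n} (entries A) v v"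
    "bilin {..<n} (entries A) v v \<le> hi * (L2_set v {..<n})\<^sup>2"
proof -
  have symA: "A $$ (i, j) = A $$ (j, i)" if "i \<in> {..<n}" "j \<in> {..<n}" for i j
    using arg_cong[OF sym, of "\<lambda>B. B $$ (j, i)"] A that by simp
  have *: "lo * (L2_set v {..<n})\<^sup>2 \<le> bilin {..<n} (entries A) v v \<and>
      bilin {..<n} (entries A) v v \<le> hi * (L2_set v {..<n})\<^sup>2"
  proof (cases "n = 0")
    case True
    then show ?thesis by (simp add: bilin_def)
  next
    case False
    then have ne: "{..<n} \<noteq> {}" by auto
    have "lo * (L2_set v {..<n})\<^sup>2 \<le> bilin {..<n} (entries A) v v"
    proof (rule rayleigh_lower_bound[OF _ ne symA])
      fix e assume "e < lo"
      then show "\<exists>R. \<forall>y. \<forall>i\<in>{..<n}. apply_on {..<n} R (\<lambda>i. apply_on {..<n} (entries A) y i - e * y i) i = y i"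
        using ev by (intro char_matrix_left_inverse[OF A]) force
    qed auto
    \<comment> \<open>The upper bound is the lower bound for -A, whose eigenvalues are the negatives
      of those of A.\<close>
    moreover have "(- hi) * (L2_set v {..<n})\<^sup>2 \<le> bilin {..<n} (\<lambda>i j. - A $$ (i, j)) v v"
    proof (rule rayleigh_lower_bound[OF _ ne])
      fix e assume "e < - hi"
      then have "\<not> eigenvalue A (- e)" using ev by force
      then obtain R where R: "\<And>y i. i < n \<Longrightarrow>
          apply_on {..<n} R (\<lambda>i. apply_on {..<n} (entries A) y i - (- e) * y i) i = y i"
        using char_matrix_left_inverse[OF A] by blast
      have "apply_on {..<n} (\<lambda>i j. - R i j) (\<lambda>i. apply_on {..<n} (\<lambda>i j. - A $$ (i, j)) y i - e * y i) i = y i"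
        if "i < n" for y i
        using R[OF that, of y] by (simp add: apply_on_def sum_negf algebra_simps sum_subtractf)
      then show "\<exists>R. \<forall>y. \<forall>i\<in>{..<n}. apply_on {..<n} R (\<lambda>i. apply_on {..<n} (\<lambda>i j. - A $$ (i, j)) y i - e * y i) i = y i"
        by blast
    qed (use symA in auto)
    ultimately show ?thesis unfolding bilin_uminus by linarith
  qed
  then show "lo * (L2_set v {..<n})\<^sup>2 \<le> bilin {..<n} (entries A) v v"
    "bilin {..<n} (entries A) v v \<le> hi * (L2_set v {..<n})\<^sup>2" by blast+
qed

lemma spectral_norm_le:
  assumes A: "A \<in> carrier_mat p p" and p: "p \<ge> 1" and b: "b \<ge> 0"
    and bil: "\<And>u v. \<bar>bilin {..<p} (entries A) u v\<bar> \<le> b * L2_set u {..<p} * L2_set v {..<p}"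
  shows "0 \<le> spectral_norm A" "spectral_norm A \<le> b"
proof -
  let ?V = "{v \<in> carrier_vec (dim_col A). scalar_prod v v = (1 :: real)}"
  let ?f = "\<lambda>v. sqrt (scalar_prod (A *\<^sub>v v) (A *\<^sub>v v))"
  have sp: "scalar_prod v v = (L2_set (\<lambda>i. v $ i) {..<p})\<^sup>2" if "v \<in> carrier_vec p" for v :: "real Matrix.vec"
    using that unfolding L2_set_square by (simp add: scalar_prod_def power2_eq_square lessThan_atLeast0)
  have le: "?f v \<le> b" if v: "v \<in> ?V" for v
  proof -
    have v': "v \<in> carrier_vec p" "L2_set (\<lambda>i. v $ i) {..<p} = 1"
      using v A sp[of v] L2_set_nonneg[of "\<lambda>i. v $ i" "{..<p}"] by (auto simp: power2_eq_1_iff)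
    let ?x = "\<lambda>i. (A *\<^sub>v v) $ i"
    have x: "?x i = apply_on {..<p} (entries A) (\<lambda>i. v $ i) i" if "i < p" for i
      using A v' that by (simp add: scalar_prod_def apply_on_def lessThan_atLeast0)
    have Av: "A *\<^sub>v v \<in> carrier_vec p" using A v' by simp
    have "(L2_set ?x {..<p})\<^sup>2 = bilin {..<p} (entries A) ?x (\<lambda>i. v $ i)"
      unfolding L2_set_square bilin_apply_on by (intro sum.cong refl) (simp add: x power2_eq_square)
    also have "\<dots> \<le> b * L2_set ?x {..<p} * 1" using bil[of ?x "\<lambda>i. v $ i"] v' by simp
    finally have "(L2_set ?x {..<p})\<^sup>2 \<le> L2_set ?x {..<p} * b" by (simp add: mult.commute)
    then have "L2_set ?x {..<p} \<le> b" by (rule le_of_square_le) (use b in auto)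
    then show ?thesis unfolding sp[OF Av] by simp
  qed
  \<comment> \<open>A unit vector exists because p \<ge> 1. The supremum in
    \<open>spectral_norm\<close> is one of real numbers, so it is informative only over a nonempty
    bounded set.\<close>
  have "scalar_prod (unit_vec p 0) (unit_vec p 0) = (1 :: real)"
    using p by (subst scalar_prod_left_unit[of _ p]) auto
  then have unit: "unit_vec p 0 \<in> ?V" using A by auto
  show "spectral_norm A \<le> b"
    unfolding spectral_norm_def using unit le by (intro cSUP_least) blast+
  have "0 \<le> ?f (unit_vec p 0)" using sp[of "A *\<^sub>v unit_vec p 0"] A by simp
  also have "\<dots> \<le> spectral_norm A"
    unfolding spectral_norm_def using le by (intro cSUP_upper unit bdd_aboveI2) blast
  finally show "0 \<le> spectral_norm A" .
qed

text \<open>A form that vanishes only at 0 makes the submatrix nonsingular, so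
  \<open>inv_mat\<close> yields a true inverse and not its default value. The maps
  \<open>pos\<close> and \<open>pick J\<close> are mutually inverse renumberings between
  \<open>J\<close> and the rows of the submatrix.\<close>

lemma submatrix_inverse:
  fixes S :: "real Matrix.mat"
  assumes S: "S \<in> carrier_mat p p" and J: "J \<subseteq> {..<p}"
    and pd: "\<And>v. L2_set v J \<noteq> 0 \<Longrightarrow> bilin J (entries S) v v \<noteq> 0"
    and i: "i \<in> J" and k: "k \<in> J"
  defines "pos \<equiv> \<lambda>i. card {a \<in> J. a < i}"
  shows "(\<Sum>j\<in>J. S $$ (i, j) * inv_mat (submatrix S J J) $$ (pos j, pos k)) = (if i = k then 1 else 0)"
proof -
  let ?d = "card J"
  let ?T = "submatrix S J J"
  have finJ: "finite J" using J finite_subset by blast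
  have Jp: "{i. i < p \<and> i \<in> J} = J" using J by auto
  have T: "?T \<in> carrier_mat ?d ?d" using S by (intro carrier_matI) (simp_all add: dim_submatrix Jp)
  have pick_pos: "pick J (pos j) = j" if "j \<in> J" for j using pick_card_in_set[OF that] by (simp add: pos_def)
  have pos_less: "pos j < ?d" if "j \<in> J" for j
    unfolding pos_def using that finJ by (intro psubset_card_mono) auto
  have pos_pick: "pos (pick J a) = a" "pick J a \<in> J" if "a < ?d" for a
    using card_pick_le[OF that] pick_in_set_le[OF that] by (simp_all add: pos_def)
  have bij: "bij_betw pos J {..<?d}"
    by (rule bij_betw_byWitness[where f' = "pick J"]) (use pick_pos pos_less pos_pick in auto)
  have Tpos: "?T $$ (pos a, pos b) = S $$ (a, b)" if "a \<in> J" "b \<in> J" for a b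
    using submatrix_index_card[of a S b J J] that J S by (auto simp: pos_def)
  have "det ?T \<noteq> 0"
  proof
    assume "det ?T = 0"
    then obtain v where v: "v \<in> carrier_vec ?d" "v \<noteq> 0\<^sub>v ?d" "?T *\<^sub>v v = 0\<^sub>v ?d"
      using det_0_iff_vec_prod_zero_field[OF T] by blast
    \<comment> \<open>A kernel vector of the submatrix, read on \<open>J\<close>, gives the value 0
      of the form and must vanish.\<close>
    define u where "u j = v $ pos j" for j
    have "apply_on J (entries S) u a = 0" if a: "a \<in> J" for a
    proof -
      have "apply_on J (entries S) u a = (\<Sum>j\<in>J. ?T $$ (pos a, pos j) * v $ pos j)"
        unfolding apply_on_def u_def by (intro sum.cong refl) (simp add: Tpos a)
      also have "\<dots> = (\<Sum>b<?d. ?T $$ (pos a, b) * v $ b)"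
        by (rule sum.reindex_bij_betw[OF bij])
      also have "\<dots> = (?T *\<^sub>v v) $ pos a"
        using T v(1) pos_less[OF a] by (simp add: scalar_prod_def lessThan_atLeast0)
      finally show ?thesis using v(3) pos_less[OF a] by simp
    qed
    then have "bilin J (entries S) u u = 0" unfolding bilin_apply_on by simp
    then have "L2_set u J = 0" using pd by blast
    then have u0: "u j = 0" if "j \<in> J" for j using that finJ by (simp add: L2_set_eq_0_iff)
    have "v = 0\<^sub>v ?d"
    proof (rule eq_vecI)
      fix a assume "a < dim_vec (0\<^sub>v ?d :: real Matrix.vec)"
      then have a: "a < ?d" by simp
      show "v $ a = 0\<^sub>v ?d $ a" using u0[OF pos_pick(2)[OF a]] a by (simp add: u_def pos_pick)
    qed (use v in simp)
    with v(2) show False ..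
  qed
  note inv = inv_mat_inverse[OF T this]
  have "(\<Sum>j\<in>J. S $$ (i, j) * inv_mat ?T $$ (pos j, pos k)) = (\<Sum>j\<in>J. ?T $$ (pos i, pos j) * inv_mat ?T $$ (pos j, pos k))"
    by (intro sum.cong refl) (simp add: Tpos i)
  also have "\<dots> = (\<Sum>b<?d. ?T $$ (pos i, b) * inv_mat ?T $$ (b, pos k))"
    by (rule sum.reindex_bij_betw[OF bij])
  also have "\<dots> = (?T * inv_mat ?T) $$ (pos i, pos k)"
    using mat_mult_entry[OF T inv(1)] pos_less i k by simp
  also have "\<dots> = (if i = k then 1 else 0)"
  proof -
    have "pos i = pos k \<longleftrightarrow> i = k" using pick_pos[OF i] pick_pos[OF k] by metis
    then show ?thesis unfolding inv(2) using pos_less[OF i] pos_less[OF k] by simp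
  qed
  finally show ?thesis .
qed

section \<open>The tapering estimator\<close>

lemma sample_cov_deviation:
  fixes n :: nat
  assumes D: "D \<in> P_class \<alpha> M0 M \<rho> p" and \<rho>: "\<rho> > 0"
    and n: "n \<ge> 1" and r: "0 < r" "r \<le> 1" "r \<le> deviation_const \<rho> * (\<rho> / 4)"
  defines "P \<equiv> Pi\<^sub>M {..<n} (\<lambda>_. D)"
  shows "\<exists>B\<in>sets P. emeasure P B \<le> ennreal (4 * exp (- (real n * r\<^sup>2 / (4 * deviation_const \<rho>)))) \<and>
    (\<forall>X\<in>space P - B. \<bar>bilin {..<p} (\<lambda>i j. sample_cov n p X $$ (i, j) - cov_mat p D $$ (i, j)) w w\<bar>
      \<le> 2 * r * (L2_set w {..<p})\<^sup>2)"
proof (cases "L2_set w {..<p} = 0")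
  case True
  then show ?thesis by (intro bexI[of _ "{}"]) (auto simp: bilin_eq_0)
next
  case False
  define a where "a = L2_set w {..<p}"
  have a: "a > 0" using False L2_set_nonneg[of w "{..<p}"] by (auto simp: a_def less_le)
  let ?w = "\<lambda>i. inverse a * w i"
  have "L2_set ?w {..<p} = 1"
    using a L2_set_right_distrib[of "inverse a" w "{..<p}"] by (simp add: a_def[symmetric])
  from sample_cov_deviation_unit[OF D \<rho> this n r] obtain B where
    B: "B \<in> sets P" "emeasure P B \<le> ennreal (4 * exp (- (real n * r\<^sup>2 / (4 * deviation_const \<rho>))))"
    and dev: "\<And>X. X \<in> space P - B \<Longrightarrow>
      \<bar>bilin {..<p} (\<lambda>i j. sample_cov n p X $$ (i, j) - cov_mat p D $$ (i, j)) ?w ?w\<bar> \<le> 2 * r"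
    unfolding P_def by blast
  have "\<bar>bilin {..<p} (\<lambda>i j. sample_cov n p X $$ (i, j) - cov_mat p D $$ (i, j)) w w\<bar> \<le> 2 * r * a\<^sup>2"
    if "X \<in> space P - B" for X
    using dev[OF that] a unfolding bilin_scale_left bilin_scale_right
    by (simp add: abs_mult field_simps power2_eq_square)
  with B show ?thesis unfolding a_def by blast
qed

text \<open>Union bound over the nets of all windows. Net vectors vanish off their window, so the
  bound for forms on the whole index set applies to them. Of the factor 4, one 2 comes from the
  deviation of a single form and the other from passing from the net to all vectors.\<close>

lemma sample_cov_deviation_windows:
  fixes n :: nat
  assumes D: "D \<in> P_class \<alpha> M0 M \<rho> p" and \<rho>: "\<rho> > 0"
    and n: "n \<ge> 1" and r: "0 < r" "r \<le> 1" "r \<le> deviation_const \<rho> * (\<rho> / 4)"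
    and fin: "finite \<J>" and sub: "\<And>J. J \<in> \<J> \<Longrightarrow> J \<subseteq> {..<p}" and card: "\<And>J. J \<in> \<J> \<Longrightarrow> card J \<le> d"
  defines "P \<equiv> Pi\<^sub>M {..<n} (\<lambda>_. D)"
  shows "\<exists>B\<in>sets P.
    emeasure P B \<le> ennreal (real (card \<J>) * 2 ^ (18 * d) * (4 * exp (- (real n * r\<^sup>2 / (4 * deviation_const \<rho>))))) \<and>
    (\<forall>X\<in>space P - B. \<forall>J\<in>\<J>. \<forall>u v.
      \<bar>bilin J (\<lambda>i j. sample_cov n p X $$ (i, j) - cov_mat p D $$ (i, j)) u v\<bar> \<le> 4 * r * L2_set u J * L2_set v J)"
proof -
  let ?\<Delta> = "\<lambda>X i j. sample_cov n p X $$ (i, j) - cov_mat p D $$ (i, j)"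
  let ?e = "4 * exp (- (real n * r\<^sup>2 / (4 * deviation_const \<rho>)))"
  define W where "W = (\<Union>J\<in>\<J>. grid_net J)"
  have finJ: "finite J" if "J \<in> \<J>" for J using sub[OF that] finite_subset by blast
  have finW: "finite W" unfolding W_def using fin finJ grid_net_card(1) by blast
  have "card W \<le> (\<Sum>J\<in>\<J>. card (grid_net J))" unfolding W_def by (rule card_UN_le[OF fin])
  also have "\<dots> \<le> (\<Sum>J\<in>\<J>. 2 ^ (18 * d))"
  proof (rule sum_mono)
    fix J assume J: "J \<in> \<J>"
    have "card (grid_net J) \<le> 2 ^ (18 * card J)" by (rule grid_net_card(2)[OF finJ[OF J]])
    also have "\<dots> \<le> 2 ^ (18 * d)" using card[OF J] by (intro power_increasing) auto
    finally show "card (grid_net J) \<le> 2 ^ (18 * d)" .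
  qed
  finally have "card W \<le> card \<J> * 2 ^ (18 * d)" by simp
  then have "real (card W) \<le> real (card \<J> * 2 ^ (18 * d))" by (rule of_nat_mono)
  then have cardW: "real (card W) \<le> real (card \<J>) * 2 ^ (18 * d)" by simp
  have "\<forall>w. \<exists>B\<in>sets P. emeasure P B \<le> ennreal ?e \<and>
      (\<forall>X\<in>space P - B. \<bar>bilin {..<p} (?\<Delta> X) w w\<bar> \<le> 2 * r * (L2_set w {..<p})\<^sup>2)"
    unfolding P_def by (intro allI sample_cov_deviation[OF D \<rho> n r])
  \<comment> \<open>An exceptional set is fixed for every vector, before the sample is considered;
    only those of the finitely many net vectors are united.\<close>
  from choice[OF this[unfolded Bex_def]] obtain B where
    *: "\<forall>w. B w \<in> sets P \<and> emeasure P (B w) \<le> ennreal ?e \<and>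
      (\<forall>X\<in>space P - B w. \<bar>bilin {..<p} (?\<Delta> X) w w\<bar> \<le> 2 * r * (L2_set w {..<p})\<^sup>2)" ..
  have B: "B w \<in> sets P" "emeasure P (B w) \<le> ennreal ?e" for w using * by simp_all
  have dev: "\<bar>bilin {..<p} (?\<Delta> X) w w\<bar> \<le> 2 * r * (L2_set w {..<p})\<^sup>2" if "X \<in> space P - B w" for w X
    using that *[rule_format, of w] by blast
  have "emeasure P (\<Union>w\<in>W. B w) \<le> (\<Sum>w\<in>W. emeasure P (B w))"
    using finW B(1) by (intro emeasure_subadditive_finite) auto
  also have "\<dots> \<le> (\<Sum>w\<in>W. ennreal ?e)" by (intro sum_mono B)
  also have "\<dots> = ennreal (real (card W) * ?e)" by (simp add: ennreal_mult ennreal_of_nat_eq_real_of_nat)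
  also have "\<dots> \<le> ennreal (real (card \<J>) * 2 ^ (18 * d) * ?e)"
    using cardW by (intro ennreal_leI mult_right_mono) auto
  finally have small: "emeasure P (\<Union>w\<in>W. B w) \<le> ennreal (real (card \<J>) * 2 ^ (18 * d) * ?e)" .
  have form: "\<bar>bilin J (?\<Delta> X) u v\<bar> \<le> 4 * r * L2_set u J * L2_set v J"
    if X: "X \<in> space P - (\<Union>w\<in>W. B w)" and J: "J \<in> \<J>" for X J u v
  proof -
    have "\<bar>bilin J (?\<Delta> X) u v\<bar> \<le> 2 * (2 * r) * L2_set u J * L2_set v J"
    proof (rule bilin_le_of_grid_net[OF finJ[OF J]])
      fix i j assume "i \<in> J" "j \<in> J"
      then have "i < p" "j < p" using sub[OF J] by auto
      then show "?\<Delta> X i j = ?\<Delta> X j i" by (simp add: sample_cov_def cov_mat_def mult.commute)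
    next
      fix w assume w: "w \<in> grid_net J"
      have w0: "w i = 0" if "i \<notin> J" for i using w that by (auto simp: grid_net_def)
      have "X \<in> space P - B w" using X w J by (auto simp: W_def)
      moreover have "bilin {..<p} (?\<Delta> X) w w = bilin J (?\<Delta> X) w w"
        by (rule bilin_superset[OF _ sub[OF J]]) (use w0 in auto)
      moreover have "L2_set w {..<p} = L2_set w J"
        by (rule L2_set_superset[OF _ sub[OF J]]) (use w0 in auto)
      ultimately show "\<bar>bilin J (?\<Delta> X) w w\<bar> \<le> 2 * r * (L2_set w J)\<^sup>2"
        using dev[of X w] by (simp only:)
    qed (use r in simp)
    then show ?thesis by simp
  qed
  show ?thesis
  proof (rule bexI, rule conjI[OF small], intro ballI allI)
    show "(\<Union>w\<in>W. B w) \<in> sets P" using finW B(1) by (intro sets.finite_UN) auto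
  qed (rule form)
qed

lemma P_class_matrix_bounds:
  assumes D: "D \<in> P_class \<alpha> M0 M \<rho> p" and M0: "M0 > 0"
  defines "\<omega> \<equiv> entries (precision_mat p D)" and "\<sigma> \<equiv> entries (cov_mat p D)"
  shows "precision_mat p D \<in> carrier_mat p p"
    and "\<And>i j. i < p \<Longrightarrow> j < p \<Longrightarrow> \<omega> i j = \<omega> j i"
    and "\<And>i k. i < p \<Longrightarrow> k < p \<Longrightarrow> (\<Sum>j<p. \<omega> i j * \<sigma> j k) = (if i = k then 1 else 0)"
    and "\<And>v. (L2_set v {..<p})\<^sup>2 / M0 \<le> bilin {..<p} \<omega> v v"
    and "\<And>u v. \<bar>bilin {..<p} \<omega> u v\<bar> \<le> M0 * L2_set u {..<p} * L2_set v {..<p}"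
    and "\<And>v. (L2_set v {..<p})\<^sup>2 / M0 \<le> bilin {..<p} \<sigma> v v"
proof -
  note PD = P_classD[OF D]
  let ?\<Omega> = "precision_mat p D" and ?\<Sigma> = "cov_mat p D"
  have \<Sigma>: "?\<Sigma> \<in> carrier_mat p p" by (simp add: cov_mat_def)
  note det = invertible_mat_det_nonzero[OF \<Sigma> PD(4)]
  note inv = inv_mat_inverse[OF \<Sigma> det, folded precision_mat_def]
  show car: "?\<Omega> \<in> carrier_mat p p" by (rule inv)
  have symT: "?\<Omega>\<^sup>T = ?\<Omega>" using PD(5) by (simp add: F_class_def)
  show sym: "\<omega> i j = \<omega> j i" if "i < p" "j < p" for i j
    using arg_cong[OF symT, of "\<lambda>B. B $$ (j, i)"] car that by (simp add: \<omega>_def)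
  have one: "(\<Sum>j<p. \<omega> i j * \<sigma> j k) = (if i = k then 1 else 0)" if "i < p" "k < p" for i k
    using mat_mult_entry[OF inv(1) \<Sigma> that] inv(3) that by (simp add: \<omega>_def \<sigma>_def)
  show "(\<Sum>j<p. \<omega> i j * \<sigma> j k) = (if i = k then 1 else 0)" if "i < p" "k < p" for i k
    by (rule one[OF that])
  have ev: "inverse M0 \<le> e \<and> e \<le> M0" if "eigenvalue ?\<Omega> e" for e using PD(5) that by (simp add: F_class_def)
  have low: "(L2_set v {..<p})\<^sup>2 / M0 \<le> bilin {..<p} \<omega> v v" for v
    using quadratic_bounds_of_eigenvalues(1)[OF car symT ev, of v] by (simp add: \<omega>_def field_simps)
  have up: "bilin {..<p} \<omega> v v \<le> M0 * (L2_set v {..<p})\<^sup>2" for v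
    using quadratic_bounds_of_eigenvalues(2)[OF car symT ev, of v] by (simp add: \<omega>_def)
  have psd: "0 \<le> bilin {..<p} \<omega> v v" for v by (rule order_trans[OF _ low]) (use M0 in simp)
  show "(L2_set v {..<p})\<^sup>2 / M0 \<le> bilin {..<p} \<omega> v v" for v by (rule low)
  show "\<bar>bilin {..<p} \<omega> u v\<bar> \<le> M0 * L2_set u {..<p} * L2_set v {..<p}" for u v
    by (rule bilin_le_of_quadratic) (use sym psd up in auto)
  show "(L2_set v {..<p})\<^sup>2 / M0 \<le> bilin {..<p} \<sigma> v v" for v
  proof -
    \<comment> \<open>With y = \<sigma> v, \<open>psd_apply_on_le\<close> for
      \<open>\<omega>\<close> reads |v|^2 \<le> M0 \<omega>(y, y) = M0 \<sigma>(v, v): the upper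
      eigenvalue bound of the precision matrix becomes the lower bound of the covariance.\<close>
    let ?y = "apply_on {..<p} \<sigma> v"
    have inv_y: "apply_on {..<p} \<omega> ?y i = v i" if i: "i < p" for i
    proof -
      have "apply_on {..<p} \<omega> ?y i = (\<Sum>a<p. \<Sum>j<p. \<omega> i a * \<sigma> a j * v j)"
        by (simp add: apply_on_def sum_distrib_left mult.assoc)
      also have "\<dots> = (\<Sum>j<p. (\<Sum>a<p. \<omega> i a * \<sigma> a j) * v j)" by (subst sum.swap) (simp add: sum_distrib_right)
      also have "\<dots> = (\<Sum>j<p. if i = j then v j else 0)" by (intro sum.cong refl) (use one i in auto)
      finally show ?thesis using i by simp
    qed
    have "(L2_set v {..<p})\<^sup>2 = (L2_set (apply_on {..<p} \<omega> ?y) {..<p})\<^sup>2"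
      using L2_set_cong[OF refl inv_y, of "{..<p}"] by simp
    also have "\<dots> \<le> M0 * bilin {..<p} \<omega> ?y ?y"
      by (rule psd_apply_on_le) (use M0 sym psd up in auto)
    also have "bilin {..<p} \<omega> ?y ?y = bilin {..<p} \<sigma> v v"
      unfolding bilin_apply_on[of _ \<omega>] unfolding bilin_apply_on
      by (intro sum.cong refl) (simp add: inv_y)
    finally show ?thesis using M0 by (simp add: field_simps)
  qed
qed

text \<open>The indices are at distance \<open>m\<close> but the decay is read off at the smaller
  \<open>h\<close>. With \<open>h\<close> half the bandwidth, the estimates for bandwidths k and k /
  2 share one bound.\<close>

lemma decay_sum_le:
  assumes \<Omega>: "\<Omega> \<in> F_class \<alpha> M0 M p" and \<alpha>: "\<alpha> > 0" and M: "M > 0" and h: "1 \<le> h" "h \<le> m"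
    and j: "j < p" and T: "T \<subseteq> {..<p}" "\<And>i. i \<in> T \<Longrightarrow> \<bar>int i - int j\<bar> \<ge> int m"
  shows "(\<Sum>i\<in>T. \<bar>\<Omega> $$ (i, j)\<bar>) \<le> M * real h powr (- \<alpha>)"
    and "(\<Sum>i\<in>T. \<bar>\<Omega> $$ (j, i)\<bar>) \<le> M * real h powr (- \<alpha>)"
proof -
  have "(\<Sum>i\<in>T. \<bar>\<Omega> $$ (i, j)\<bar>) \<le> (\<Sum>i | i < p \<and> \<bar>int i - int j\<bar> \<ge> int m. \<bar>\<Omega> $$ (i, j)\<bar>)"
    using T by (intro sum_mono2) auto
  also have "\<dots> \<le> M * real m powr (- \<alpha>)" using \<Omega> j h by (auto simp: F_class_def)
  also have "\<dots> \<le> M * real h powr (- \<alpha>)" using M \<alpha> h by (intro mult_left_mono powr_mono2') auto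
  finally show *: "(\<Sum>i\<in>T. \<bar>\<Omega> $$ (i, j)\<bar>) \<le> M * real h powr (- \<alpha>)" .
  have car: "\<Omega> \<in> carrier_mat p p" and symT: "\<Omega>\<^sup>T = \<Omega>" using \<Omega> by (auto simp: F_class_def)
  have "(\<Sum>i\<in>T. \<bar>\<Omega> $$ (j, i)\<bar>) = (\<Sum>i\<in>T. \<bar>\<Omega> $$ (i, j)\<bar>)"
  proof (intro sum.cong refl)
    fix i assume "i \<in> T"
    then show "\<bar>\<Omega> $$ (j, i)\<bar> = \<bar>\<Omega> $$ (i, j)\<bar>"
      using arg_cong[OF symT, of "\<lambda>B. B $$ (j, i)"] car T(1) j by auto
  qed
  with * show "(\<Sum>i\<in>T. \<bar>\<Omega> $$ (j, i)\<bar>) \<le> M * real h powr (- \<alpha>)" by simp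
qed

section \<open>Cores, windows and taper weights\<close>

definition core :: "nat \<Rightarrow> nat \<Rightarrow> int \<Rightarrow> nat set" where
  "core p m l = {i. i < p \<and> l \<le> int i \<and> int i < l + int m}"

lemma core_subset: "core p m l \<subseteq> window p m l" "window p m l \<subseteq> {..<p}"
  by (auto simp: core_def window_def)

lemma local_inverse_entry:
  assumes "i < p" "j < p"
  shows "local_inverse p S m l $$ (i, j) = (if i \<in> core p m l \<and> j \<in> core p m l then
    inv_mat (submatrix S (window p m l) (window p m l)) $$
      (card {a \<in> window p m l. a < i}, card {a \<in> window p m l. a < j}) else 0)"
  using assms by (simp add: local_inverse_def core_def Let_def)

text \<open>These triangular weights produce the taper: the weight for k minus that for k / 2, times
  2 / k, is 1 up to distance k / 2 and falls linearly to 0 at distance k. The lowest position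
  \<open>l = - m\<close> has an empty core and contributes nothing.\<close>

lemma core_multiplicity:
  assumes i: "i < p" "j < p"
  shows "card {l \<in> {- int m..<int p}. i \<in> core p m l \<and> j \<in> core p m l} = nat (int m - \<bar>int i - int j\<bar>)"
proof -
  have "{l \<in> {- int m..<int p}. i \<in> core p m l \<and> j \<in> core p m l} =
      {max (int i) (int j) - int m + 1..min (int i) (int j)}"
    using i by (auto simp: core_def)
  moreover have "min (int i) (int j) - (max (int i) (int j) - int m + 1) + 1 = int m - \<bar>int i - int j\<bar>"
    by linarith
  ultimately show ?thesis by (simp only: card_atLeastAtMost_int)
qed

definition window_error :: "real \<Rightarrow> real \<Rightarrow> real \<Rightarrow> real" where
  "window_error M0 t \<beta> = 2 * M0\<^sup>2 * t + \<beta> * M0 * (\<beta> + 2 * M0\<^sup>2 * t)"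

text \<open>Each local inverse is compared with the block of the precision matrix on its core, and
  these blocks add up with the weights of \<open>core_multiplicity\<close>. Overlaps cost the factor
  \<open>m\<close>, which the normalisation 2 / k later removes.\<close>

lemma local_inverse_sum_error:
  assumes D: "D \<in> P_class \<alpha> M0 M \<rho> p" and pos: "\<alpha> > 0" "M > 0" "M0 > 0"
    and h: "1 \<le> h" "h \<le> m" and t: "0 \<le> t" "t \<le> 1 / (2 * M0)"
    and S: "S \<in> carrier_mat p p"
    and dev: "\<And>l u v. l \<in> {- int m..<int p} \<Longrightarrow>
      \<bar>bilin (window p m l) (\<lambda>i j. S $$ (i, j) - cov_mat p D $$ (i, j)) u v\<bar>
        \<le> t * L2_set u (window p m l) * L2_set v (window p m l)"
  shows "\<bar>bilin {..<p} (\<lambda>i j. (\<Sum>l\<in>{- int m..<int p}. local_inverse p S m l $$ (i, j)) -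
      real_of_int (max 0 (int m - \<bar>int i - int j\<bar>)) * precision_mat p D $$ (i, j)) u v\<bar>
    \<le> window_error M0 t (M * real h powr (- \<alpha>)) * real m * L2_set u {..<p} * L2_set v {..<p}"
proof -
  define \<beta> where "\<beta> = M * real h powr (- \<alpha>)"
  have \<beta>: "\<beta> \<ge> 0" using pos by (simp add: \<beta>_def)
  let ?\<omega> = "entries (precision_mat p D)" and ?\<sigma> = "entries (cov_mat p D)"
  note b = P_class_matrix_bounds[OF D pos(3)]
  note F = P_classD(5)[OF D]
  note decay = decay_sum_le[OF F pos(1,2) h, folded \<beta>_def]
  let ?L = "{- int m..<int p}"
  let ?E = "\<lambda>l i j. local_inverse p S m l $$ (i, j) - (if i \<in> core p m l \<and> j \<in> core p m l then ?\<omega> i j else 0)"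
  have split: "(\<Sum>l\<in>?L. ?E l i j) = (\<Sum>l\<in>?L. local_inverse p S m l $$ (i, j)) -
      real_of_int (max 0 (int m - \<bar>int i - int j\<bar>)) * precision_mat p D $$ (i, j)" if "i < p" "j < p" for i j
  proof -
    have "(\<Sum>l\<in>?L. if i \<in> core p m l \<and> j \<in> core p m l then ?\<omega> i j else 0) =
        real (card {l \<in> ?L. i \<in> core p m l \<and> j \<in> core p m l}) * ?\<omega> i j"
      by (simp add: sum.inter_filter[symmetric])
    moreover have "real (nat z) = real_of_int (max 0 z)" for z :: int by (cases "z \<ge> 0") auto
    ultimately show ?thesis using core_multiplicity[OF that, of m] by (simp add: sum_subtractf)
  qed
  have "\<bar>bilin {..<p} (\<lambda>i j. \<Sum>l\<in>?L. ?E l i j) u v\<bar> \<le> window_error M0 t \<beta> * real m * L2_set u {..<p} * L2_set v {..<p}"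
  proof (rule bilin_block_sum_le[where B = "core p m"])
    fix l and u v :: "nat \<Rightarrow> real" assume l: "l \<in> ?L"
    let ?J = "window p m l" and ?K = "core p m l"
    let ?g = "\<lambda>i j. inv_mat (submatrix S ?J ?J) $$ (card {a \<in> ?J. a < i}, card {a \<in> ?J. a < j})"
    have KI: "?K \<subseteq> {..<p}" using core_subset by blast
    \<comment> \<open>On each window the form of \<open>S\<close> keeps at least half of the lower
      bound of \<open>\<sigma>\<close>, so the submatrix to be inverted is nonsingular.\<close>
    have pd: "bilin ?J (entries S) v v \<noteq> 0" if "L2_set v ?J \<noteq> 0" for v
    proof -
      let ?v = "\<lambda>i. if i \<in> ?J then v i else 0"
      have "L2_set ?v {..<p} = L2_set ?v ?J" by (rule L2_set_superset) (use core_subset in auto)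
      moreover have "L2_set ?v ?J = L2_set v ?J" by (rule L2_set_cong) auto
      moreover have "bilin {..<p} ?\<sigma> ?v ?v = bilin ?J ?\<sigma> ?v ?v" by (rule bilin_superset) (use core_subset in auto)
      moreover have "bilin ?J ?\<sigma> ?v ?v = bilin ?J ?\<sigma> v v" by (rule bilin_cong) auto
      ultimately have "(L2_set v ?J)\<^sup>2 / M0 \<le> bilin ?J ?\<sigma> v v" using b(6)[of ?v] by simp
      moreover have "bilin ?J ?\<sigma> v v - bilin ?J (entries S) v v \<le> t * (L2_set v ?J)\<^sup>2"
        using dev[OF l, of v v] unfolding bilin_diff_matrix by (simp add: power2_eq_square mult.assoc)
      moreover have "t * (L2_set v ?J)\<^sup>2 \<le> 1 / (2 * M0) * (L2_set v ?J)\<^sup>2" using t by (intro mult_right_mono) auto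
      moreover have "(L2_set v ?J)\<^sup>2 / M0 = 2 * (1 / (2 * M0) * (L2_set v ?J)\<^sup>2)" by simp
      moreover have "1 / (2 * M0) * (L2_set v ?J)\<^sup>2 > 0" using that pos by simp
      ultimately show ?thesis by linarith
    qed
    have "\<bar>bilin ?K (\<lambda>i j. ?g i j - ?\<omega> i j) u v\<bar> \<le> window_error M0 t \<beta> * L2_set u ?K * L2_set v ?K"
      unfolding window_error_def
    proof (rule window_perturbation[where I = "{..<p}" and J = ?J and \<sigma> = ?\<sigma> and S = "entries S"])
      fix u :: "nat \<Rightarrow> real" assume u: "\<And>i. i \<notin> ?K \<Longrightarrow> u i = 0"
      \<comment> \<open>A window extends its core by \<open>m\<close> on both sides; this margin is
        the distance at which the decay of the precision matrix is used.\<close>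
      have far: "\<bar>int i - int j\<bar> \<ge> int m" if "i \<in> {..<p} - ?J" "j \<in> ?K" for i j
        using that by (auto simp: core_def window_def)
      show "L2_set (apply_on {..<p} ?\<omega> u) ({..<p} - ?J) \<le> \<beta> * L2_set u ?K"
      proof (rule L2_set_apply_on_le_schur[OF _ KI u _ _ \<beta>])
        fix i assume i: "i \<in> {..<p} - ?J"
        show "(\<Sum>j\<in>?K. \<bar>?\<omega> i j\<bar>) \<le> \<beta>"
          by (rule decay(2)) (use i KI far[OF i] in \<open>auto simp: abs_minus_commute\<close>)
      next
        fix j assume j: "j \<in> ?K"
        show "(\<Sum>i\<in>{..<p} - ?J. \<bar>?\<omega> i j\<bar>) \<le> \<beta>"
          by (rule decay(1)) (use j KI far[OF _ j] in auto)
      qed auto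
    next
      fix i k assume "i \<in> ?J" "k \<in> ?J"
      then show "(\<Sum>j\<in>?J. S $$ (i, j) * ?g j k) = (if i = k then 1 else 0)"
        by (intro submatrix_inverse[OF S core_subset(2) pd])
    qed (use core_subset b pos t \<beta> dev[OF l] in auto)
    also have "bilin ?K (\<lambda>i j. ?g i j - ?\<omega> i j) u v = bilin ?K (?E l) u v"
    proof (rule bilin_cong)
      fix i j assume ij: "i \<in> ?K" "j \<in> ?K"
      then have "i < p" "j < p" using KI by auto
      with ij show "?g i j - ?\<omega> i j = ?E l i j" by (simp add: local_inverse_entry)
    qed auto
    finally show "\<bar>bilin ?K (?E l) u v\<bar> \<le> window_error M0 t \<beta> * L2_set u ?K * L2_set v ?K" .
  next
    fix i assume "i \<in> {..<p}"
    then show "card {l \<in> ?L. i \<in> core p m l} \<le> m" using core_multiplicity[of i p i m] by simp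
  next
    fix l i j assume "i \<in> {..<p}" "j \<in> {..<p}" "\<not> (i \<in> core p m l \<and> j \<in> core p m l)"
    then show "?E l i j = 0" by (auto simp: local_inverse_entry)
  qed (use subset_trans[OF core_subset] pos t \<beta> in \<open>auto simp: window_error_def\<close>)
  also have "bilin {..<p} (\<lambda>i j. \<Sum>l\<in>?L. ?E l i j) u v = bilin {..<p} (\<lambda>i j. (\<Sum>l\<in>?L. local_inverse p S m l $$ (i, j)) -
      real_of_int (max 0 (int m - \<bar>int i - int j\<bar>)) * precision_mat p D $$ (i, j)) u v"
    by (rule bilin_cong) (use split in auto)
  finally show ?thesis unfolding \<beta>_def .
qed

lemma tapering_error:
  assumes D: "D \<in> P_class \<alpha> M0 M \<rho> p" and pos: "\<alpha> > 0" "M > 0" "M0 > 0"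
    and k: "k = 2 * h" "1 \<le> h" "k \<le> p" and t: "0 \<le> t" "t \<le> 1 / (2 * M0)"
    and dev: "\<And>m l u v. m \<in> {k, h} \<Longrightarrow> l \<in> {- int m..<int p} \<Longrightarrow>
      \<bar>bilin (window p m l) (\<lambda>i j. sample_cov n p X $$ (i, j) - cov_mat p D $$ (i, j)) u v\<bar>
        \<le> t * L2_set u (window p m l) * L2_set v (window p m l)"
  defines "\<beta> \<equiv> M * real h powr (- \<alpha>)"
  shows "0 \<le> spectral_norm (tapering_estimator n p k X - precision_mat p D)"
    "spectral_norm (tapering_estimator n p k X - precision_mat p D) \<le> 3 * window_error M0 t \<beta> + \<beta>"
proof -
  have \<beta>: "\<beta> \<ge> 0" using pos by (simp add: \<beta>_def)
  let ?\<omega> = "entries (precision_mat p D)"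
  let ?S = "sample_cov n p X"
  note F = P_classD(5)[OF D]
  have car: "precision_mat p D \<in> carrier_mat p p" using P_class_matrix_bounds(1)[OF D pos(3)] .
  have S: "?S \<in> carrier_mat p p" by (simp add: sample_cov_def)
  have decay: "(\<Sum>i\<in>T. \<bar>precision_mat p D $$ (i, j)\<bar>) \<le> \<beta>" "(\<Sum>i\<in>T. \<bar>precision_mat p D $$ (j, i)\<bar>) \<le> \<beta>"
    if "j < p" "T \<subseteq> {..<p}" "\<And>i. i \<in> T \<Longrightarrow> \<bar>int i - int j\<bar> \<ge> int h" for j T
    using decay_sum_le[OF F pos(1,2) k(2) order_refl that] unfolding \<beta>_def by blast+
  let ?e = "window_error M0 t \<beta>"
  define c where "c m i j = real_of_int (max 0 (int m - \<bar>int i - int j\<bar>))" for m i j :: nat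
  define E where "E m i j = (\<Sum>l\<in>{- int m..<int p}. local_inverse p ?S m l $$ (i, j)) - c m i j * ?\<omega> i j" for m i j
  have E: "\<bar>bilin {..<p} (E m) u v\<bar> \<le> ?e * real m * L2_set u {..<p} * L2_set v {..<p}" if "m \<in> {k, h}" for m u v
    unfolding E_def c_def \<beta>_def
    by (rule local_inverse_sum_error[OF D pos k(2) _ t S]) (use that k dev in auto)
  \<comment> \<open>The bias of the taper. Its weight is exactly 1 at distances below
    \<open>h\<close> and lies between 0 and 1 elsewhere, so \<open>R\<close> retains only entries
    far from the diagonal, with modulus not increased.\<close>
  define R where "R i j = (2 / real k * (c k i j - c h i j) - 1) * ?\<omega> i j" for i j
  have near: "R i j = 0" if "\<bar>int i - int j\<bar> < int h" for i j
    using that k by (simp add: R_def c_def max_def)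
  have R_le: "\<bar>R i j\<bar> \<le> \<bar>?\<omega> i j\<bar>" for i j
  proof -
    have "0 \<le> c k i j - c h i j" "c k i j - c h i j \<le> real h" using k(1) by (auto simp: c_def max_def)
    then have "\<bar>2 / real k * (c k i j - c h i j) - 1\<bar> \<le> 1" using k by (simp add: field_simps abs_le_iff)
    from mult_right_mono[OF this, of "\<bar>?\<omega> i j\<bar>"] show ?thesis by (simp add: R_def abs_mult)
  qed
  have R: "\<bar>bilin {..<p} R u v\<bar> \<le> \<beta> * L2_set u {..<p} * L2_set v {..<p}" for u v
    unfolding bilin_def
  proof (rule bilin_schur_test[OF _ _ \<beta>])
    fix i assume i: "i \<in> {..<p}"
    let ?T = "{j \<in> {..<p}. \<bar>int j - int i\<bar> \<ge> int h}"
    have "(\<Sum>j<p. \<bar>R i j\<bar>) = (\<Sum>j\<in>?T. \<bar>R i j\<bar>)"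
      by (rule sum.mono_neutral_right) (auto intro!: near)
    also have "\<dots> \<le> (\<Sum>j\<in>?T. \<bar>?\<omega> i j\<bar>)" by (intro sum_mono R_le)
    also have "\<dots> \<le> \<beta>" by (rule decay(2)) (use i in auto)
    finally show "(\<Sum>j<p. \<bar>R i j\<bar>) \<le> \<beta>" .
    have "(\<Sum>j<p. \<bar>R j i\<bar>) = (\<Sum>j\<in>?T. \<bar>R j i\<bar>)"
      by (rule sum.mono_neutral_right) (auto intro!: near)
    also have "\<dots> \<le> (\<Sum>j\<in>?T. \<bar>?\<omega> j i\<bar>)" by (intro sum_mono R_le)
    also have "\<dots> \<le> \<beta>" by (rule decay(1)) (use i in auto)
    finally show "(\<Sum>j<p. \<bar>R j i\<bar>) \<le> \<beta>" .
  qed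
  let ?A = "tapering_estimator n p k X - precision_mat p D"
  have entry: "?A $$ (i, j) = 2 / real k * (E k i j - E h i j) + R i j" if "i \<in> {..<p}" "j \<in> {..<p}" for i j
    using that car k(1) by (simp add: tapering_estimator_def Let_def E_def R_def algebra_simps)
  have bound: "\<bar>bilin {..<p} (entries ?A) u v\<bar> \<le> (3 * ?e + \<beta>) * L2_set u {..<p} * L2_set v {..<p}" for u v
  proof -
    have "bilin {..<p} (entries ?A) u v = bilin {..<p} (\<lambda>i j. 2 / real k * (E k i j - E h i j) + R i j) u v"
      by (rule bilin_cong) (use entry in auto)
    also have "\<dots> = 2 / real k * (bilin {..<p} (E k) u v - bilin {..<p} (E h) u v) + bilin {..<p} R u v"
      unfolding bilin_add_matrix bilin_scale_matrix bilin_diff_matrix ..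
    also have "\<bar>\<dots>\<bar> \<le> 2 / real k * (\<bar>bilin {..<p} (E k) u v\<bar> + \<bar>bilin {..<p} (E h) u v\<bar>) + \<bar>bilin {..<p} R u v\<bar>"
      by (intro order_trans[OF abs_triangle_ineq] add_right_mono) (simp add: abs_mult divide_right_mono)
    also have "\<dots> \<le> 2 / real k * (?e * real k * L2_set u {..<p} * L2_set v {..<p} +
        ?e * real h * L2_set u {..<p} * L2_set v {..<p}) + \<beta> * L2_set u {..<p} * L2_set v {..<p}"
      by (intro add_mono mult_left_mono E R) auto
    \<comment> \<open>The factor 3 is \<open>2 / k * (k + h)\<close> with
      \<open>h = k / 2\<close>.\<close>
    also have "\<dots> = (3 * ?e + \<beta>) * L2_set u {..<p} * L2_set v {..<p}"
      using k by (simp add: field_simps)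
    finally show ?thesis .
  qed
  have carA: "?A \<in> carrier_mat p p" by (rule minus_carrier_mat[OF car])
  have "3 * ?e + \<beta> \<ge> 0" using \<beta> pos t by (simp add: window_error_def)
  from spectral_norm_le[OF carA _ this bound] k
  show "0 \<le> spectral_norm ?A" "spectral_norm ?A \<le> 3 * ?e + \<beta>" by auto
qed

section \<open>Constants and the probability bound\<close>

lemma card_window_le: "card (window p m l) \<le> 3 * m"
proof -
  have "card (window p m l) = card (int ` window p m l)" by (simp add: card_image)
  also have "\<dots> \<le> card {l - int m..<l + 2 * int m}" by (rule card_mono) (auto simp: window_def)
  also have "\<dots> = 3 * m" by simp
  finally show ?thesis .
qed

text \<open>The deviation level is \<open>r\<^sup>2 = 216 * deviation_const \<rho> * x\<close> with \<open>x = (k + ln p) / n\<close>, for which the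
  Chernoff exponent \<open>n * r\<^sup>2 / (4 * deviation_const \<rho>)\<close> is \<open>54 * (k + ln p)\<close>; this beats the net size
  \<open>2 ^ (54 * k)\<close> of a window of at most \<open>3 * k\<close> indices.\<close>

definition rate_const :: "real \<Rightarrow> real \<Rightarrow> real \<Rightarrow> real \<Rightarrow> real" where
  "rate_const \<alpha> M0 M \<rho> =
    2 * (6 * M0\<^sup>2 + 6 * M * M0 ^ 3)\<^sup>2 * (16 * (216 * deviation_const \<rho>)) + 2 * (3 * M0 * M + 1)\<^sup>2 * (M\<^sup>2 * 4 powr \<alpha>) + 1"

text \<open>The largest x = (k + ln p) / n for which the deviation level r meets three demands, one
  for each entry of the minimum: r^2 \<le> r, the range of the Chernoff bound, and 4 r \<le> 1 / (2
  M0) for the inversion of the windows.\<close>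

definition rate_threshold :: "real \<Rightarrow> real \<Rightarrow> real" where
  "rate_threshold M0 \<rho> = (min 1 (min (deviation_const \<rho> * (\<rho> / 4)) (1 / (8 * M0))))\<^sup>2 / (216 * deviation_const \<rho>)"

lemma rate_threshold_pos: "M0 > 0 \<Longrightarrow> \<rho> > 0 \<Longrightarrow> rate_threshold M0 \<rho> > 0"
  using deviation_const_pos[of \<rho>] by (auto simp: rate_threshold_def min_def intro!: divide_pos_pos)

lemma rate_const_pos: "M > 0 \<Longrightarrow> M0 > 0 \<Longrightarrow> \<rho> > 0 \<Longrightarrow> rate_const \<alpha> M0 M \<rho> > 0"
  using deviation_const_pos[of \<rho>] by (auto simp: rate_const_def intro!: add_nonneg_pos add_nonneg_nonneg mult_nonneg_nonneg)

lemma tapering_error_square: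
  assumes pos: "\<alpha> > 0" "M > 0" "M0 > 0" "\<rho> > 0" and x: "x > 0" and k: "k = 2 * h" "1 \<le> h"
    and s: "0 \<le> s" "s \<le> 3 * window_error M0 (4 * sqrt (216 * deviation_const \<rho> * x)) (M * real h powr (- \<alpha>))
      + M * real h powr (- \<alpha>)"
  shows "s\<^sup>2 < rate_const \<alpha> M0 M \<rho> * x + rate_const \<alpha> M0 M \<rho> * real k powr (- 2 * \<alpha>)"
proof -
  define t where "t = 4 * sqrt (216 * deviation_const \<rho> * x)"
  define \<beta> where "\<beta> = M * real h powr (- \<alpha>)"
  define A where "A = 6 * M0\<^sup>2 + 6 * M * M0 ^ 3"
  define B where "B = 3 * M0 * M + 1"
  define C1 where "C1 = 2 * A\<^sup>2 * (16 * (216 * deviation_const \<rho>))"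
  define C2 where "C2 = 2 * B\<^sup>2 * (M\<^sup>2 * 4 powr \<alpha>)"
  note dc = deviation_const_pos[OF pos(4)]
  have t: "t \<ge> 0" "t\<^sup>2 = 16 * (216 * deviation_const \<rho>) * x" using dc x by (simp_all add: t_def power_mult_distrib)
  \<comment> \<open>As h \<ge> 1, \<open>\<beta>\<close> is at most \<open>M\<close>. This makes the
    products \<beta>^2 and \<beta> t of the window error linear, and collecting terms gives the
    coefficients \<open>A\<close> and \<open>B\<close>.\<close>
  have "real h powr (- \<alpha>) \<le> 1 powr (- \<alpha>)" using pos k by (intro powr_mono2') auto
  then have \<beta>: "0 \<le> \<beta>" "\<beta> \<le> M" using pos by (auto simp: \<beta>_def)
  \<comment> \<open>Passing from h = k / 2 back to k costs the factor 4^\<alpha>.\<close>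
  have \<beta>2: "\<beta>\<^sup>2 = M\<^sup>2 * 4 powr \<alpha> * real k powr (- 2 * \<alpha>)"
  proof -
    have "real k powr (- 2 * \<alpha>) = 2 powr (- 2 * \<alpha>) * real h powr (- 2 * \<alpha>)"
      using k by (simp add: powr_mult)
    moreover have "(4::real) powr \<alpha> = 2 powr (2 * \<alpha>)" by (simp add: powr_powr[symmetric])
    moreover have "(2::real) powr (2 * \<alpha>) * 2 powr (- 2 * \<alpha>) = 1" by (simp add: powr_add[symmetric])
    moreover have "(real h powr (- \<alpha>))\<^sup>2 = real h powr (- 2 * \<alpha>)"
      by (simp add: power2_eq_square powr_add[symmetric])
    ultimately show ?thesis by (simp add: \<beta>_def power_mult_distrib)
  qed
  have "3 * window_error M0 t \<beta> + \<beta> = 6 * M0\<^sup>2 * t + 3 * M0 * (\<beta> * \<beta>) + 6 * M0 ^ 3 * (\<beta> * t) + \<beta>"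
    by (simp add: window_error_def algebra_simps power2_eq_square power3_eq_cube)
  also have "\<dots> \<le> 6 * M0\<^sup>2 * t + 3 * M0 * (M * \<beta>) + 6 * M0 ^ 3 * (M * t) + \<beta>"
    using \<beta> t pos by (intro add_mono mult_left_mono mult_right_mono order_refl) auto
  also have "\<dots> = A * t + B * \<beta>" by (simp add: A_def B_def algebra_simps)
  finally have sAB: "s \<le> A * t + B * \<beta>" using s(2) by (simp add: t_def \<beta>_def)
  have "s\<^sup>2 \<le> (A * t + B * \<beta>)\<^sup>2" using sAB s(1) by (intro power_mono)
  also have "\<dots> \<le> 2 * (A * t)\<^sup>2 + 2 * (B * \<beta>)\<^sup>2"
    using sum_squares_bound[of "A * t" "B * \<beta>"] by (simp add: power2_sum)
  also have "\<dots> = C1 * x + C2 * real k powr (- 2 * \<alpha>)"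
    unfolding power_mult_distrib t(2) \<beta>2 C1_def C2_def by (simp add: algebra_simps)
  \<comment> \<open>The summand 1 in the constant makes the inequality strict, as it must contradict
    a failure event defined by \<ge>.\<close>
  also have "\<dots> < (C1 + C2 + 1) * x + (C1 + C2 + 1) * real k powr (- 2 * \<alpha>)"
  proof -
    have "C1 \<ge> 0" "C2 \<ge> 0" using dc by (auto simp: C1_def C2_def)
    then have "C1 * x < (C1 + C2 + 1) * x" "C2 * real k powr (- 2 * \<alpha>) \<le> (C1 + C2 + 1) * real k powr (- 2 * \<alpha>)"
      using x by (auto intro!: mult_strict_right_mono mult_right_mono)
    then show ?thesis by linarith
  qed
  also have "C1 + C2 + 1 = rate_const \<alpha> M0 M \<rho>" by (simp add: C1_def C2_def A_def B_def rate_const_def)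
  finally show ?thesis .
qed

lemma error_prob_le:
  assumes D: "D \<in> P_class \<alpha> M0 M \<rho> p" and pos: "\<alpha> > 0" "M > 0" "M0 > 0" "\<rho> > 0"
    and n: "n \<ge> 1" and k: "even k" "1 \<le> k" "k \<le> p"
    and small: "(real k + ln (real p)) / real n \<le> rate_threshold M0 \<rho>"
    and b: "b \<ge> rate_const \<alpha> M0 M \<rho> * ((real k + ln (real p)) / real n) + rate_const \<alpha> M0 M \<rho> * real k powr (- 2 * \<alpha>)"
  shows "emeasure (Pi\<^sub>M {..<n} (\<lambda>_. D)) {X \<in> space (Pi\<^sub>M {..<n} (\<lambda>_. D)).
      (spectral_norm (tapering_estimator n p k X - precision_mat p D))\<^sup>2 \<ge> b} \<le> ennreal (16 * real p powr (- 15))"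
proof -
  let ?P = "Pi\<^sub>M {..<n} (\<lambda>_. D)"
  define x where "x = (real k + ln (real p)) / real n"
  define r where "r = sqrt (216 * deviation_const \<rho> * x)"
  note dc = deviation_const_pos[OF pos(4)]
  obtain h where h: "k = 2 * h" using k(1) by (auto elim: evenE)
  have h1: "1 \<le> h" using h k by auto
  have lnp: "ln (real p) \<ge> 0" using k by simp
  have x: "x > 0" using lnp k n by (auto simp: x_def intro!: divide_pos_pos add_pos_nonneg)
  have r0: "r > 0" using x dc by (simp add: r_def)
  let ?m = "min 1 (min (deviation_const \<rho> * (\<rho> / 4)) (1 / (8 * M0)))"
  have "r\<^sup>2 \<le> ?m\<^sup>2"
  proof -
    have "r\<^sup>2 = 216 * deviation_const \<rho> * x" using x dc by (simp add: r_def)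
    also have "\<dots> \<le> 216 * deviation_const \<rho> * rate_threshold M0 \<rho>"
      using small dc by (intro mult_left_mono) (auto simp: x_def)
    also have "\<dots> = ?m\<^sup>2" using dc by (simp add: rate_threshold_def)
    finally show ?thesis .
  qed
  moreover have "?m \<ge> 0" using dc pos by simp
  ultimately have "r \<le> ?m" using power2_le_imp_le by blast
  then have r: "r \<le> 1" "r \<le> deviation_const \<rho> * (\<rho> / 4)" "4 * r \<le> 1 / (2 * M0)"
    using pos by (auto simp: field_simps)
  \<comment> \<open>Both bandwidths occur. There are at most (p + k) + (p + h) windows, which is at
    most 4 p because k \<le> p.\<close>
  define \<J> where "\<J> = window p k ` {- int k..<int p} \<union> window p h ` {- int h..<int p}"
  have "card \<J> \<le> card (window p k ` {- int k..<int p}) + card (window p h ` {- int h..<int p})"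
    unfolding \<J>_def by (rule card_Un_le)
  also have "\<dots> \<le> card {- int k..<int p} + card {- int h..<int p}" by (intro add_mono card_image_le) auto
  also have "\<dots> \<le> 4 * p" using k h by simp
  finally have card\<J>: "card \<J> \<le> 4 * p" .
  have fin: "finite \<J>" by (simp add: \<J>_def)
  have sub: "J \<subseteq> {..<p}" if "J \<in> \<J>" for J using that core_subset(2) by (auto simp: \<J>_def)
  have cardJ: "card J \<le> 3 * k" if J: "J \<in> \<J>" for J
    using J card_window_le[of p k] card_window_le[of p h] h by (fastforce simp: \<J>_def intro: order_trans)
  obtain B where B: "B \<in> sets ?P"
      "emeasure ?P B \<le> ennreal (real (card \<J>) * 2 ^ (18 * (3 * k)) * (4 * exp (- (real n * r\<^sup>2 / (4 * deviation_const \<rho>)))))"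
    and dev: "\<And>X J u v. X \<in> space ?P - B \<Longrightarrow> J \<in> \<J> \<Longrightarrow>
      \<bar>bilin J (\<lambda>i j. sample_cov n p X $$ (i, j) - cov_mat p D $$ (i, j)) u v\<bar> \<le> 4 * r * L2_set u J * L2_set v J"
    using sample_cov_deviation_windows[OF D pos(4) n r0 r(1,2) fin sub cardJ] by blast
  \<comment> \<open>The failure event is enclosed in the measurable set \<open>B\<close>. This
    bounds its \<open>emeasure\<close> whether or not it is measurable itself, as
    \<open>emeasure\<close> is 0 outside the sigma-algebra.\<close>
  have "{X \<in> space ?P. (spectral_norm (tapering_estimator n p k X - precision_mat p D))\<^sup>2 \<ge> b} \<subseteq> B"
  proof
    fix X assume "X \<in> {X \<in> space ?P. (spectral_norm (tapering_estimator n p k X - precision_mat p D))\<^sup>2 \<ge> b}"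
    then have X: "X \<in> space ?P" "(spectral_norm (tapering_estimator n p k X - precision_mat p D))\<^sup>2 \<ge> b" by auto
    show "X \<in> B"
    proof (rule ccontr)
      assume "X \<notin> B"
      then have XB: "X \<in> space ?P - B" using X by blast
      have W: "\<bar>bilin (window p m l) (\<lambda>i j. sample_cov n p X $$ (i, j) - cov_mat p D $$ (i, j)) u v\<bar>
          \<le> 4 * r * L2_set u (window p m l) * L2_set v (window p m l)"
        if "m \<in> {k, h}" "l \<in> {- int m..<int p}" for m l u v
        using that by (intro dev[OF XB]) (auto simp: \<J>_def)
      have "0 \<le> 4 * r" using r0 by simp
      note err = tapering_error[OF D pos(1-3) h h1 k(3) this r(3) W]
      have "(spectral_norm (tapering_estimator n p k X - precision_mat p D))\<^sup>2 < b"
        using tapering_error_square[OF pos x h h1 err[unfolded r_def]] b by (simp add: x_def)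
      with X(2) show False by simp
    qed
  qed
  then have "emeasure ?P {X \<in> space ?P. (spectral_norm (tapering_estimator n p k X - precision_mat p D))\<^sup>2 \<ge> b} \<le> emeasure ?P B"
    using B(1) by (rule emeasure_mono)
  also note B(2)
  also have "ennreal (real (card \<J>) * 2 ^ (18 * (3 * k)) * (4 * exp (- (real n * r\<^sup>2 / (4 * deviation_const \<rho>)))))
      \<le> ennreal (16 * real p powr (- 15))"
  proof (rule ennreal_leI)
    have "real n * r\<^sup>2 / (4 * deviation_const \<rho>) = 54 * (real n * x)" using x dc by (simp add: r_def)
    also have "real n * x = real k + ln (real p)" using n by (simp add: x_def)
    finally have "exp (- (real n * r\<^sup>2 / (4 * deviation_const \<rho>))) = exp (- (54 * real k)) * exp (- (54 * ln (real p)))"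
      by (simp add: exp_add[symmetric])
    also have "exp (- (54 * ln (real p))) = real p powr (- 54)" using k by (simp add: powr_def)
    finally have e: "exp (- (real n * r\<^sup>2 / (4 * deviation_const \<rho>))) = exp (- (54 * real k)) * real p powr (- 54)" .
    \<comment> \<open>Since 2 \<le> e, the part exp(-54 k) of the Chernoff factor cancels the net
      count. The part p^(-54) loses one power of p to the number of windows; 16 is 4 from that
      number times 4 from the deviation bound.\<close>
    have "(2::real) ^ (18 * (3 * k)) \<le> exp 1 ^ (18 * (3 * k))"
      using exp_ge_add_one_self[of 1] by (intro power_mono) auto
    also have "\<dots> = exp (54 * real k)" by (simp flip: exp_of_nat_mult)
    finally have two: "(2::real) ^ (18 * (3 * k)) \<le> exp (54 * real k)" .
    have "real (card \<J>) * 2 ^ (18 * (3 * k)) * (4 * exp (- (real n * r\<^sup>2 / (4 * deviation_const \<rho>))))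
        \<le> real (4 * p) * exp (54 * real k) * (4 * (exp (- (54 * real k)) * real p powr (- 54)))"
      unfolding e using card\<J> two by (intro mult_mono) auto
    also have "\<dots> = 16 * (real p powr 1 * real p powr (- 54)) * (exp (54 * real k) * exp (- (54 * real k)))"
      using k by simp
    also have "real p powr 1 * real p powr (- 54) = real p powr (- 53)" unfolding powr_add[symmetric] by simp
    also have "16 * real p powr (- 53) * (exp (54 * real k) * exp (- (54 * real k))) = 16 * real p powr (- 53)"
      by (simp add: exp_add[symmetric])
    also have "\<dots> \<le> 16 * real p powr (- 15)" using k by (intro mult_left_mono powr_mono) auto
    finally show "real (card \<J>) * 2 ^ (18 * (3 * k)) * (4 * exp (- (real n * r\<^sup>2 / (4 * deviation_const \<rho>)))) \<le> 16 * real p powr (- 15)" .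
  qed
  finally show ?thesis .
qed

section \<open>Supremum over the class and the two rates\<close>

lemma sup_error_prob_le:
  assumes pos: "\<alpha> > 0" "M > 0" "M0 > 0" "\<rho> > 0"
    and n: "n \<ge> 1" and k: "even k" "1 \<le> k" "k \<le> p"
    and small: "(real k + ln (real p)) / real n \<le> rate_threshold M0 \<rho>"
    and b: "b \<ge> rate_const \<alpha> M0 M \<rho> * ((real k + ln (real p)) / real n) + rate_const \<alpha> M0 M \<rho> * real k powr (- 2 * \<alpha>)"
  shows "\<bar>sup_error_prob \<alpha> M0 M \<rho> n p k b\<bar> \<le> 16 * \<bar>real p powr (- 15)\<bar>"
proof -
  have "sup_error_prob \<alpha> M0 M \<rho> n p k b \<le> 16 * real p powr (- 15)"
    unfolding sup_error_prob_def
    by (rule enn2real_leI, simp, rule SUP_least, rule error_prob_le[OF _ pos n k small b])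
  moreover have "sup_error_prob \<alpha> M0 M \<rho> n p k b \<ge> 0" by (simp add: sup_error_prob_def)
  ultimately show ?thesis by simp
qed

text \<open>Common core of both rates. The o(n) conditions bring (k + ln p) / n below the threshold,
  after which the constant 16 works for every member of the class; the level \<open>b\<close> only
  has to dominate the nonasymptotic rate.\<close>

lemma bigo_sup_error_prob:
  assumes pos: "\<alpha> > 0" "M > 0" "M0 > 0" "\<rho> > 0"
    and pk: "\<And>n. n \<ge> 1 \<Longrightarrow> even (k n) \<and> 1 \<le> k n \<and> k n \<le> p n"
    and k: "(\<lambda>n. real (k n)) \<in> o(\<lambda>n. real n)" and p: "(\<lambda>n. ln (real (p n))) \<in> o(\<lambda>n. real n)"
    and b: "\<And>n. n \<ge> 1 \<Longrightarrow> b n \<ge> rate_const \<alpha> M0 M \<rho> * ((real (k n) + ln (real (p n))) / real n)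
      + rate_const \<alpha> M0 M \<rho> * real (k n) powr (- 2 * \<alpha>)"
  shows "(\<lambda>n. sup_error_prob \<alpha> M0 M \<rho> n (p n) (k n) (b n)) \<in> O(\<lambda>n. real (p n) powr (- 15))"
proof (rule bigoI)
  \<comment> \<open>Half of the threshold is granted to k / n and half to ln p / n.\<close>
  define \<delta> where "\<delta> = rate_threshold M0 \<rho> / 2"
  have \<delta>: "\<delta> > 0" using rate_threshold_pos[OF pos(3,4)] by (simp add: \<delta>_def)
  show "\<forall>\<^sub>F n in at_top. norm (sup_error_prob \<alpha> M0 M \<rho> n (p n) (k n) (b n)) \<le> 16 * norm (real (p n) powr (- 15))"
    using landau_o.smallD[OF k \<delta>] landau_o.smallD[OF p \<delta>] eventually_ge_at_top[of 1]
  proof eventually_elim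
    case (elim n)
    have "real (k n) + ln (real (p n)) \<le> rate_threshold M0 \<rho> * real n"
      using elim by (simp add: \<delta>_def)
    then have "(real (k n) + ln (real (p n))) / real n \<le> rate_threshold M0 \<rho>"
      using elim by (simp add: field_simps)
    then show ?case
      using sup_error_prob_le[OF pos elim(3) _ _ _ _ b[OF elim(3)]] pk[OF elim(3)] by simp
  qed
qed

text \<open>The bandwidth n^\<gamma> is in general no even integer, hence the slack below 2. It is
  absorbed into factors because n^\<gamma> is at least 1 and a positive even \<open>k\<close> is at
  least 2.\<close>

lemma even_near_powr_bounds:
  fixes k n :: nat
  assumes n: "n \<ge> 1" and k: "even k" "1 \<le> k" and \<gamma>: "\<gamma> \<ge> 0" and close: "\<bar>real k - real n powr \<gamma>\<bar> < 2"
  shows "real k \<le> 3 * real n powr \<gamma>" "real n powr \<gamma> / 2 \<le> real k"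
proof -
  have "real n powr \<gamma> \<ge> 1" using n \<gamma> by (intro ge_one_powr_ge_zero) auto
  moreover have "k \<ge> 2" using k by (auto elim: evenE)
  then have "real k \<ge> 2" by simp
  ultimately show "real k \<le> 3 * real n powr \<gamma>" "real n powr \<gamma> / 2 \<le> real k" using close by linarith+
qed

theorem theorem3p1:
  fixes \<alpha> M M0 \<rho> :: real
  assumes "\<alpha> > 0" and "M > 0" and "M0 > 0" and "\<rho> > 0"
  shows "\<exists>C>0.
    (\<forall>p k :: nat \<Rightarrow> nat.
       (\<forall>n\<ge>1. real (p n) > real n powr (1 / (2 * \<alpha> + 1)) \<and>
               1 \<le> k n \<and> k n \<le> p n \<and> even (k n)) \<longrightarrow>
       (\<lambda>n. real (k n)) \<in> o(\<lambda>n. real n) \<longrightarrow>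
       (\<lambda>n. ln (real (p n))) \<in> o(\<lambda>n. real n) \<longrightarrow>
       (\<lambda>n. sup_error_prob \<alpha> M0 M \<rho> n (p n) (k n)
              (C * ((real (k n) + ln (real (p n))) / real n) + C * real (k n) powr (- 2 * \<alpha>)))
         \<in> O(\<lambda>n. real (p n) powr (- 15))) \<and>
    (\<forall>p k :: nat \<Rightarrow> nat.
       (\<forall>n\<ge>1. real (p n) > real n powr (1 / (2 * \<alpha> + 1)) \<and>
               1 \<le> k n \<and> k n \<le> p n \<and> even (k n) \<and>
               \<bar>real (k n) - real n powr (1 / (2 * \<alpha> + 1))\<bar> < 2) \<longrightarrow>
       (\<lambda>n. ln (real (p n))) \<in> o(\<lambda>n. real n) \<longrightarrow>
       (\<lambda>n. sup_error_prob \<alpha> M0 M \<rho> n (p n) (k n)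
              (C * real n powr (- (2 * \<alpha> / (2 * \<alpha> + 1))) + C * (ln (real (p n)) / real n)))
         \<in> O(\<lambda>n. real (p n) powr (- 15)))"
proof -
  define R where "R = rate_const \<alpha> M0 M \<rho>"
  \<comment> \<open>In the second rate, 3 comes from k \<le> 3 n^\<gamma> and 4^\<alpha> from k
    \<ge> n^\<gamma> / 2 raised to the power -2 \<alpha>. As the bracket is at least 1, the same
    constant also covers the first rate.\<close>
  define C where "C = R * (3 + 4 powr \<alpha>)"
  define \<gamma> where "\<gamma> = 1 / (2 * \<alpha> + 1)"
  note pos = assms
  have R: "R > 0" using rate_const_pos[OF pos(2-4)] by (simp add: R_def)
  have q: "3 + 4 powr \<alpha> \<ge> 1" using powr_ge_zero[of 4 \<alpha>] by linarith
  have C: "C > 0" "R \<le> C" using R q mult_left_mono[OF q, of R] mult_pos_pos[of R "3 + 4 powr \<alpha>"]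
    unfolding C_def by linarith+
  \<comment> \<open>The exponent \<gamma> balances the stochastic term k / n against the squared
    bias k^(-2 \<alpha>); both become n^(-2 \<alpha> / (2 \<alpha> + 1)).\<close>
  have \<gamma>: "0 \<le> \<gamma>" "\<gamma> - 1 = - (2 * \<alpha> / (2 * \<alpha> + 1))" "\<gamma> * (- 2 * \<alpha>) = - (2 * \<alpha> / (2 * \<alpha> + 1))"
    using pos(1) by (auto simp: \<gamma>_def field_simps)
  show ?thesis
  proof (intro exI[of _ C] conjI allI impI)
    fix p k :: "nat \<Rightarrow> nat"
    assume pk: "\<forall>n\<ge>1. real (p n) > real n powr (1 / (2 * \<alpha> + 1)) \<and> 1 \<le> k n \<and> k n \<le> p n \<and> even (k n)"
      and k: "(\<lambda>n. real (k n)) \<in> o(\<lambda>n. real n)" and p: "(\<lambda>n. ln (real (p n))) \<in> o(\<lambda>n. real n)"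
    show "(\<lambda>n. sup_error_prob \<alpha> M0 M \<rho> n (p n) (k n)
              (C * ((real (k n) + ln (real (p n))) / real n) + C * real (k n) powr (- 2 * \<alpha>)))
         \<in> O(\<lambda>n. real (p n) powr (- 15))"
    proof (rule bigo_sup_error_prob[OF pos _ k p], fold R_def)
      fix n :: nat assume n: "n \<ge> 1"
      then have "real (p n) \<ge> 1" using pk by (metis le_trans of_nat_1 of_nat_le_iff)
      then show "R * ((real (k n) + ln (real (p n))) / real n) + R * real (k n) powr (- 2 * \<alpha>)
          \<le> C * ((real (k n) + ln (real (p n))) / real n) + C * real (k n) powr (- 2 * \<alpha>)"
        using C(2) by (intro add_mono mult_right_mono divide_nonneg_nonneg add_nonneg_nonneg) auto
    qed (use pk in auto)
  next
    fix p k :: "nat \<Rightarrow> nat"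
    assume pk: "\<forall>n\<ge>1. real (p n) > real n powr (1 / (2 * \<alpha> + 1)) \<and> 1 \<le> k n \<and> k n \<le> p n \<and> even (k n) \<and>
               \<bar>real (k n) - real n powr (1 / (2 * \<alpha> + 1))\<bar> < 2"
      and p: "(\<lambda>n. ln (real (p n))) \<in> o(\<lambda>n. real n)"
    have kb: "real (k n) \<le> 3 * real n powr \<gamma>" "real n powr \<gamma> / 2 \<le> real (k n)" if "n \<ge> 1" for n
      using even_near_powr_bounds[OF that _ _ \<gamma>(1), of "k n"] pk that by (auto simp: \<gamma>_def)
    have "(\<lambda>n. real (k n)) \<in> O(\<lambda>n. real n powr \<gamma>)"
      by (rule bigoI[of _ 3]) (use kb in \<open>auto intro!: eventually_mono[OF eventually_ge_at_top[of 1]]\<close>)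
    \<comment> \<open>Here \<alpha> > 0 gives \<gamma> < 1, so for this bandwidth k = o(n) is a
      consequence and not an assumption.\<close>
    also have "(\<lambda>n. real n powr \<gamma>) \<in> o(\<lambda>n. real n powr 1)"
      using pos(1) by (subst powr_smallo_iff) (auto simp: \<gamma>_def filterlim_real_sequentially)
    also have "(\<lambda>n. real n powr 1) \<in> \<Theta>(\<lambda>n. real n)" by simp
    finally have k: "(\<lambda>n. real (k n)) \<in> o(\<lambda>n. real n)" .
    show "(\<lambda>n. sup_error_prob \<alpha> M0 M \<rho> n (p n) (k n)
              (C * real n powr (- (2 * \<alpha> / (2 * \<alpha> + 1))) + C * (ln (real (p n)) / real n)))
         \<in> O(\<lambda>n. real (p n) powr (- 15))"
    proof (rule bigo_sup_error_prob[OF pos _ k p], fold R_def)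
      fix n :: nat assume n: "n \<ge> 1"
      then have "p n \<ge> 1" using pk le_trans by blast
      then have L: "ln (real (p n)) / real n \<ge> 0" by simp
      let ?q = "real n powr (- (2 * \<alpha> / (2 * \<alpha> + 1)))"
      have "real (k n) / real n \<le> 3 * real n powr \<gamma> / real n powr 1"
        using kb(1)[OF n] n by (simp add: divide_right_mono)
      also have "\<dots> = 3 * ?q" by (simp add: \<gamma>(2)[symmetric] powr_diff)
      finally have k1: "real (k n) / real n \<le> 3 * ?q" .
      have "real (k n) powr (- 2 * \<alpha>) \<le> (real n powr \<gamma> / 2) powr (- 2 * \<alpha>)"
        using kb(2)[OF n] n pos(1) by (intro powr_mono2') auto
      also have "\<dots> = (real n powr \<gamma>) powr (- 2 * \<alpha>) / 2 powr (- 2 * \<alpha>)" by (simp add: powr_divide)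
      also have "\<dots> = (real n powr \<gamma>) powr (- 2 * \<alpha>) * 2 powr (2 * \<alpha>)" by (simp add: powr_minus field_simps)
      also have "(2::real) powr (2 * \<alpha>) = 4 powr \<alpha>" by (simp add: powr_powr[symmetric])
      also have "(real n powr \<gamma>) powr (- 2 * \<alpha>) = ?q" unfolding powr_powr \<gamma>(3) ..
      finally have k2: "real (k n) powr (- 2 * \<alpha>) \<le> ?q * 4 powr \<alpha>" .
      have "R * ((real (k n) + ln (real (p n))) / real n) + R * real (k n) powr (- 2 * \<alpha>) =
          R * (real (k n) / real n + real (k n) powr (- 2 * \<alpha>)) + R * (ln (real (p n)) / real n)"
        by (simp add: algebra_simps add_divide_distrib)
      also have "\<dots> \<le> R * (3 * ?q + ?q * 4 powr \<alpha>) + C * (ln (real (p n)) / real n)"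
        using k1 k2 R C L by (intro add_mono mult_left_mono mult_right_mono) auto
      also have "R * (3 * ?q + ?q * 4 powr \<alpha>) = C * ?q" by (simp add: C_def algebra_simps)
      finally show "R * ((real (k n) + ln (real (p n))) / real n) + R * real (k n) powr (- 2 * \<alpha>)
          \<le> C * ?q + C * (ln (real (p n)) / real n)" .
    qed (use pk in auto)
  qed (rule C(1))
qed

end
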